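(* Let $M\times_\lambda N$ be the singly warped product of Riemannian manifolds $(M,g)$ and $(N,h)$ with smooth warping function $\lambda:M\to(0,+\infty)$, let $y_0\in N$, and let $f:M\to\mathbb R$ be a smooth positive non-constant function. The inclusion map $i_{y_0}:(M,g)\to M\times_\lambda N$, $i_{y_0}(x)=(x,y_0)$, is a non-trivial bi-$f$-harmonic map if and only if $$2f\big(\mathrm{Tr}_g\,{}^M\nabla^2\,\mathrm{grad}_gf+{}^M\mathrm{Ric}(\mathrm{grad}_gf)\big)+\mathrm{grad}_g\big(|\mathrm{grad}_gf|^2\big)=0.$$
   Context: $M\times_\lambda N$ is $M\times N$ with the metric $\bar g=g\oplus\lambda^2h$. Curvature convention: $R(X,Y)Z=\nabla_X\nabla_YZ-\nabla_Y\nabla_XZ-\nabla_{[X,Y]}Z$. For a local $g$-orthonormal frame $\{e_j\}$: ${}^M\mathrm{Ric}(X)=\sum_jR^M(X,e_j)e_j$ and $\mathrm{Tr}_g{}^M\nabla^2X=\sum_j({}^M\nabla_{e_j}{}^M\nabla_{e_j}X-{}^M\nabla_{{}^M\nabla_{e_j}e_j}X)$. For a smooth map $\phi:(M,g)\to(P,k)$ of Riemannian manifolds and a positive smooth function $f$ on $M$: $\tau(\phi)=\mathrm{Tr}_g\nabla d\phi$; the $f$-tension field is $\tau_f(\phi)=f\tau(\phi)+d\phi(\mathrm{grad}\,f)$ ($\phi$ is $f$-harmonic iff $\tau_f(\phi)=0$). $\phi$ is bi-$f$-harmonic if it is a critical point of $E_{f,2}(\phi)=\frac12\int_\Omega|\tau_f(\phi)|^2dv_g$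 for every compact domain $\Omega\subset M$; equivalently the bi-$f$-tension field $$\tau_{f,2}(\phi)=-f\,\mathrm{Tr}_g(\nabla^\phi)^2\tau_f(\phi)-f\,\mathrm{Tr}_gR^P(\tau_f(\phi),d\phi)d\phi-\nabla^\phi_{\mathrm{grad}f}\tau_f(\phi)$$ vanishes, where $\nabla^\phi$ is the pull-back connection, $\mathrm{Tr}_g(\nabla^\phi)^2V=\sum_j(\nabla^\phi_{e_j}\nabla^\phi_{e_j}V-\nabla^\phi_{\nabla_{e_j}e_j}V)$ and $\mathrm{Tr}_gR^P(V,d\phi)d\phi=\sum_jR^P(V,d\phi(e_j))d\phi(e_j)$. A bi-$f$-harmonic map is non-trivial if it is not $f$-harmonic.
   Formalization: M is assumed connected (otherwise a locally constant, non-constant f satisfies the equation although the inclusion is f-harmonic, hence trivial); the manifolds M and N have positive dimension. *)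

theory Defs
  imports "HOL-Analysis.Analysis"
begin

section \<open>Smooth maps between open subsets of Euclidean spaces\<close>

abbreviation fderiv :: "('a::real_normed_vector \<Rightarrow> 'b::real_normed_vector) \<Rightarrow> 'a \<Rightarrow> 'a \<Rightarrow> 'b" where
  "fderiv f x v \<equiv> frechet_derivative f (at x) v"

text \<open>Both notions are meant for open \<open>S\<close> only.\<close>

primrec cont_diff_on ::
  "nat \<Rightarrow> 'a::real_normed_vector set \<Rightarrow> ('a \<Rightarrow> 'b::real_normed_vector) \<Rightarrow> bool" where
  "cont_diff_on 0 S f \<longleftrightarrow> continuous_on S f"
| "cont_diff_on (Suc n) S f \<longleftrightarrow>
     (\<forall>x\<in>S. f differentiable at x) \<and> (\<forall>v. cont_diff_on n S (\<lambda>x. fderiv f x v))"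

definition smooth_on ::
  "'a::real_normed_vector set \<Rightarrow> ('a \<Rightarrow> 'b::real_normed_vector) \<Rightarrow> bool" where
  "smooth_on S f \<longleftrightarrow> (\<forall>n. cont_diff_on n S f)"


section \<open>Riemannian geometry in a coordinate domain\<close>

text \<open>
  Inside a chart, a Riemannian metric is a function \<open>G\<close> giving an inner product \<open>G x\<close> on the model
  space for every coordinate point \<open>x\<close>, and a vector field is a function into the model space.
  All operators below are differential operators, so their value at a point depends only on the
  germs of the arguments at that point.
\<close>

type_synonym 'e metric_field = "'e \<Rightarrow> 'e \<Rightarrow> 'e \<Rightarrow> real"

definition riemannian_metric_on :: "'e::euclidean_space set \<Rightarrow> 'e metric_field \<Rightarrow> bool" where
  "riemannian_metric_on S G \<longleftrightarrow>
     (\<forall>x\<in>S. bilinear (G x) \<and> (\<forall>u v. G x u v = G x v u) \<and> (\<forall>u. u \<noteq> 0 \<longrightarrow> G x u u > 0)) \<and>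
     (\<forall>u v. smooth_on S (\<lambda>x. G x u v))"

definition gradient :: "'e::euclidean_space metric_field \<Rightarrow> ('e \<Rightarrow> real) \<Rightarrow> 'e \<Rightarrow> 'e" where
  "gradient G f x = (THE w. \<forall>z. G x w z = fderiv f x z)"

text \<open>
  The Levi-Civita derivative of the constant coordinate field \<open>v\<close> in direction \<open>u\<close>: this is the
  Koszul formula for the constant (hence commuting) fields \<open>u\<close>, \<open>v\<close>, \<open>z\<close>. It packages the
  Christoffel symbols of \<open>G\<close>.
\<close>

definition christoffel :: "'e::euclidean_space metric_field \<Rightarrow> 'e \<Rightarrow> 'e \<Rightarrow> 'e \<Rightarrow> 'e" where
  "christoffel G x u v =
     (THE w. \<forall>z. 2 * G x w z =
        fderiv (\<lambda>y. G y v z) x u + fderiv (\<lambda>y. G y u z) x v - fderiv (\<lambda>y. G y u v) x z)"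

definition cov :: "'e::euclidean_space metric_field \<Rightarrow> ('e \<Rightarrow> 'e) \<Rightarrow> ('e \<Rightarrow> 'e) \<Rightarrow> 'e \<Rightarrow> 'e" where
  "cov G X Y x = fderiv Y x (X x) + christoffel G x (X x) (Y x)"

definition lie_bracket :: "('e::euclidean_space \<Rightarrow> 'e) \<Rightarrow> ('e \<Rightarrow> 'e) \<Rightarrow> 'e \<Rightarrow> 'e" where
  "lie_bracket X Y x = fderiv Y x (X x) - fderiv X x (Y x)"

definition curvature_field ::
  "'e::euclidean_space metric_field \<Rightarrow> ('e \<Rightarrow> 'e) \<Rightarrow> ('e \<Rightarrow> 'e) \<Rightarrow> ('e \<Rightarrow> 'e) \<Rightarrow> 'e \<Rightarrow> 'e" where
  "curvature_field G X Y Z x =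
     cov G X (cov G Y Z) x - cov G Y (cov G X Z) x - cov G (lie_bracket X Y) Z x"

text \<open>
  The curvature is tensorial; its value on tangent vectors at \<open>x\<close> is computed by extending them
  to constant coordinate fields.
\<close>

definition curvature :: "'e::euclidean_space metric_field \<Rightarrow> 'e \<Rightarrow> 'e \<Rightarrow> 'e \<Rightarrow> 'e \<Rightarrow> 'e" where
  "curvature G x u v w = curvature_field G (\<lambda>_. u) (\<lambda>_. v) (\<lambda>_. w) x"

text \<open>
  A smooth orthonormal frame near \<open>x\<close>, indexed by the standard basis of the model space merely to
  have \<open>DIM('e)\<close> members. Traces do not depend on the frame, so any one of them may be used.
\<close>

definition orthonormal_frame_near ::
  "'e::euclidean_space metric_field \<Rightarrow> 'e \<Rightarrow> ('e \<Rightarrow> 'e \<Rightarrow> 'e) \<Rightarrow> bool" where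
  "orthonormal_frame_near G x e \<longleftrightarrow>
     (\<exists>W. open W \<and> x \<in> W \<and> (\<forall>j\<in>Basis. smooth_on W (e j)) \<and>
        (\<forall>y\<in>W. \<forall>i\<in>Basis. \<forall>j\<in>Basis. G y (e i y) (e j y) = (if i = j then 1 else 0)))"

definition frame :: "'e::euclidean_space metric_field \<Rightarrow> 'e \<Rightarrow> 'e \<Rightarrow> 'e \<Rightarrow> 'e" where
  "frame G x = (SOME e. orthonormal_frame_near G x e)"

definition ricci :: "'e::euclidean_space metric_field \<Rightarrow> ('e \<Rightarrow> 'e) \<Rightarrow> 'e \<Rightarrow> 'e" where
  "ricci G X x =
     (let e = frame G x in \<Sum>j\<in>Basis. curvature G x (X x) (e j x) (e j x))"

definition trace_cov2 :: "'e::euclidean_space metric_field \<Rightarrow> ('e \<Rightarrow> 'e) \<Rightarrow> 'e \<Rightarrow> 'e" where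
  "trace_cov2 G X x =
     (let e = frame G x in
      \<Sum>j\<in>Basis. cov G (e j) (cov G (e j) X) x - cov G (cov G (e j) (e j)) X x)"

text \<open>
  For a map \<open>\<phi>\<close> from a domain with metric \<open>G\<close> to a domain with metric \<open>K\<close>: the pull-back connection
  on fields \<open>V\<close> along \<open>\<phi>\<close>, the differential applied to a field, and the tension fields.
\<close>

definition cov_along ::
  "'p::euclidean_space metric_field \<Rightarrow> ('e::euclidean_space \<Rightarrow> 'p) \<Rightarrow> ('e \<Rightarrow> 'e) \<Rightarrow> ('e \<Rightarrow> 'p) \<Rightarrow> 'e \<Rightarrow> 'p"
where
  "cov_along K \<phi> X V x = fderiv V x (X x) + christoffel K (\<phi> x) (fderiv \<phi> x (X x)) (V x)"

definition dmap ::
  "('e::euclidean_space \<Rightarrow> 'p::euclidean_space) \<Rightarrow> ('e \<Rightarrow> 'e) \<Rightarrow> 'e \<Rightarrow> 'p" where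
  "dmap \<phi> X x = fderiv \<phi> x (X x)"

definition tension ::
  "'e::euclidean_space metric_field \<Rightarrow> 'p::euclidean_space metric_field \<Rightarrow> ('e \<Rightarrow> 'p) \<Rightarrow> 'e \<Rightarrow> 'p" where
  "tension G K \<phi> x =
     (let e = frame G x in
      \<Sum>j\<in>Basis. cov_along K \<phi> (e j) (dmap \<phi> (e j)) x - dmap \<phi> (cov G (e j) (e j)) x)"

definition f_tension ::
  "'e::euclidean_space metric_field \<Rightarrow> 'p::euclidean_space metric_field \<Rightarrow> ('e \<Rightarrow> real) \<Rightarrow>
   ('e \<Rightarrow> 'p) \<Rightarrow> 'e \<Rightarrow> 'p" where
  "f_tension G K f \<phi> x = f x *\<^sub>R tension G K \<phi> x + dmap \<phi> (gradient G f) x"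

definition trace_cov2_along ::
  "'e::euclidean_space metric_field \<Rightarrow> 'p::euclidean_space metric_field \<Rightarrow> ('e \<Rightarrow> 'p) \<Rightarrow>
   ('e \<Rightarrow> 'p) \<Rightarrow> 'e \<Rightarrow> 'p" where
  "trace_cov2_along G K \<phi> V x =
     (let e = frame G x in
      \<Sum>j\<in>Basis. cov_along K \<phi> (e j) (cov_along K \<phi> (e j) V) x
                - cov_along K \<phi> (cov G (e j) (e j)) V x)"

definition trace_curvature_along ::
  "'e::euclidean_space metric_field \<Rightarrow> 'p::euclidean_space metric_field \<Rightarrow> ('e \<Rightarrow> 'p) \<Rightarrow>
   ('e \<Rightarrow> 'p) \<Rightarrow> 'e \<Rightarrow> 'p" where
  "trace_curvature_along G K \<phi> V x =
     (let e = frame G x in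
      \<Sum>j\<in>Basis. curvature K (\<phi> x) (V x) (dmap \<phi> (e j) x) (dmap \<phi> (e j) x))"

definition bi_f_tension ::
  "'e::euclidean_space metric_field \<Rightarrow> 'p::euclidean_space metric_field \<Rightarrow> ('e \<Rightarrow> real) \<Rightarrow>
   ('e \<Rightarrow> 'p) \<Rightarrow> 'e \<Rightarrow> 'p" where
  "bi_f_tension G K f \<phi> x =
     - (f x *\<^sub>R trace_cov2_along G K \<phi> (f_tension G K f \<phi>) x)
     - f x *\<^sub>R trace_curvature_along G K \<phi> (f_tension G K f \<phi>) x
     - cov_along K \<phi> (gradient G f) (f_tension G K f \<phi>) x"


section \<open>Riemannian manifolds\<close>

text \<open>
  A Riemannian manifold is a Hausdorff second countable space with a smooth atlas in which every
  chart carries the coordinate expression of the metric. That these expressions come from one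
  metric tensor on the manifold is the requirement that all transition maps be isometries.
  The atlas need not be maximal.
\<close>

record ('a, 'e) chart =
  chart_dom :: "'a set"
  chart_map :: "'a \<Rightarrow> 'e"
  chart_metric :: "'e \<Rightarrow> 'e \<Rightarrow> 'e \<Rightarrow> real"

record ('a, 'e) riem =
  mtop :: "'a topology"
  atlas :: "('a, 'e) chart set"

abbreviation chart_image :: "('a, 'e) chart \<Rightarrow> 'e set" where
  "chart_image c \<equiv> chart_map c ` chart_dom c"

abbreviation chart_inv :: "('a, 'e) chart \<Rightarrow> 'e \<Rightarrow> 'a" where
  "chart_inv c \<equiv> inv_into (chart_dom c) (chart_map c)"

definition riemannian_chart :: "'a topology \<Rightarrow> ('a, 'e::euclidean_space) chart \<Rightarrow> bool" where
  "riemannian_chart T c \<longleftrightarrow>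
     openin T (chart_dom c) \<and> open (chart_image c) \<and>
     homeomorphic_map (subtopology T (chart_dom c)) (top_of_set (chart_image c)) (chart_map c) \<and>
     riemannian_metric_on (chart_image c) (chart_metric c)"

definition compatible_charts ::
  "('a, 'e::euclidean_space) chart \<Rightarrow> ('a, 'e) chart \<Rightarrow> bool" where
  "compatible_charts c d \<longleftrightarrow>
     (let S = chart_map c ` (chart_dom c \<inter> chart_dom d); \<theta> = chart_map d \<circ> chart_inv c in
      smooth_on S \<theta> \<and>
      (\<forall>x\<in>S. \<forall>u v. chart_metric c x u v
                    = chart_metric d (\<theta> x) (fderiv \<theta> x u) (fderiv \<theta> x v)))"

definition second_countable_space :: "'a topology \<Rightarrow> bool" where
  "second_countable_space T \<longleftrightarrow>
     (\<exists>\<B>. countable \<B> \<and> (\<forall>V\<in>\<B>. openin T V) \<and>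
        (\<forall>U x. openin T U \<and> x \<in> U \<longrightarrow> (\<exists>V\<in>\<B>. x \<in> V \<and> V \<subseteq> U)))"

definition riemannian_manifold :: "('a, 'e::euclidean_space) riem \<Rightarrow> bool" where
  "riemannian_manifold M \<longleftrightarrow>
     Hausdorff_space (mtop M) \<and> second_countable_space (mtop M) \<and>
     (\<Union>c\<in>atlas M. chart_dom c) = topspace (mtop M) \<and>
     (\<forall>c\<in>atlas M. riemannian_chart (mtop M) c) \<and>
     (\<forall>c\<in>atlas M. \<forall>d\<in>atlas M. compatible_charts c d)"

definition smooth_function :: "('a, 'e::euclidean_space) riem \<Rightarrow> ('a \<Rightarrow> real) \<Rightarrow> bool" where
  "smooth_function M f \<longleftrightarrow> (\<forall>c\<in>atlas M. smooth_on (chart_image c) (f \<circ> chart_inv c))"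

definition smooth_map ::
  "('a, 'e::euclidean_space) riem \<Rightarrow> ('b, 'p::euclidean_space) riem \<Rightarrow> ('a \<Rightarrow> 'b) \<Rightarrow> bool" where
  "smooth_map M P \<phi> \<longleftrightarrow>
     continuous_map (mtop M) (mtop P) \<phi> \<and>
     (\<forall>c\<in>atlas M. \<forall>d\<in>atlas P.
        smooth_on (chart_map c ` {p \<in> chart_dom c. \<phi> p \<in> chart_dom d})
                  (chart_map d \<circ> \<phi> \<circ> chart_inv c))"

text \<open>
  A field along \<open>\<phi>\<close> vanishes iff its components vanish in all charts of the source and the target.
  The vanishing of the bi-f-tension field is the Euler-Lagrange equation of the bi-f-energy, which
  is taken as the definition of a bi-f-harmonic map.
\<close>

definition f_harmonic ::
  "('a, 'e::euclidean_space) riem \<Rightarrow> ('b, 'p::euclidean_space) riem \<Rightarrow> ('a \<Rightarrow> real) \<Rightarrow>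
   ('a \<Rightarrow> 'b) \<Rightarrow> bool" where
  "f_harmonic M P f \<phi> \<longleftrightarrow>
     smooth_map M P \<phi> \<and>
     (\<forall>c\<in>atlas M. \<forall>d\<in>atlas P. \<forall>p\<in>chart_dom c. \<phi> p \<in> chart_dom d \<longrightarrow>
        f_tension (chart_metric c) (chart_metric d) (f \<circ> chart_inv c)
          (chart_map d \<circ> \<phi> \<circ> chart_inv c) (chart_map c p) = 0)"

definition bi_f_harmonic ::
  "('a, 'e::euclidean_space) riem \<Rightarrow> ('b, 'p::euclidean_space) riem \<Rightarrow> ('a \<Rightarrow> real) \<Rightarrow>
   ('a \<Rightarrow> 'b) \<Rightarrow> bool" where
  "bi_f_harmonic M P f \<phi> \<longleftrightarrow>
     smooth_map M P \<phi> \<and>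
     (\<forall>c\<in>atlas M. \<forall>d\<in>atlas P. \<forall>p\<in>chart_dom c. \<phi> p \<in> chart_dom d \<longrightarrow>
        bi_f_tension (chart_metric c) (chart_metric d) (f \<circ> chart_inv c)
          (chart_map d \<circ> \<phi> \<circ> chart_inv c) (chart_map c p) = 0)"

definition nontrivial_bi_f_harmonic ::
  "('a, 'e::euclidean_space) riem \<Rightarrow> ('b, 'p::euclidean_space) riem \<Rightarrow> ('a \<Rightarrow> real) \<Rightarrow>
   ('a \<Rightarrow> 'b) \<Rightarrow> bool" where
  "nontrivial_bi_f_harmonic M P f \<phi> \<longleftrightarrow> bi_f_harmonic M P f \<phi> \<and> \<not> f_harmonic M P f \<phi>"


section \<open>Singly warped products\<close>

definition warped_chart ::
  "('a \<Rightarrow> real) \<Rightarrow> ('a, 'e) chart \<Rightarrow> ('b, 'f) chart \<Rightarrow> ('a \<times> 'b, 'e \<times> 'f) chart" where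
  "warped_chart lam c d =
     \<lparr> chart_dom = chart_dom c \<times> chart_dom d,
       chart_map = map_prod (chart_map c) (chart_map d),
       chart_metric = (\<lambda>(x, y) (u, v) (u', v').
         chart_metric c x u u' + (lam (chart_inv c x))\<^sup>2 * chart_metric d y v v') \<rparr>"

definition warped_product ::
  "('a, 'e) riem \<Rightarrow> ('a \<Rightarrow> real) \<Rightarrow> ('b, 'f) riem \<Rightarrow> ('a \<times> 'b, 'e \<times> 'f) riem" where
  "warped_product M lam N =
     \<lparr> mtop = prod_topology (mtop M) (mtop N),
       atlas = {warped_chart lam c d |c d. c \<in> atlas M \<and> d \<in> atlas N} \<rparr>"

end

theory Submission
  imports Defs
begin

text \<open>
  The inclusion is totally geodesic: at horizontal vectors the Christoffel symbols of
  \<open>g \<oplus> \<lambda>\<^sup>2h\<close> are those of \<open>g\<close>, and in charts the inclusion is an isometric change of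
  coordinates followed by \<open>x \<mapsto> (x, b)\<close>. A totally geodesic map \<open>\<phi>\<close> has tension zero and
  satisfies \<open>\<nabla>\<^sup>\<phi> (d\<phi> Y) = d\<phi> (\<nabla> Y)\<close>; commuting two such derivatives shows that it
  also carries the curvature of the source to that of the target. Hence its \<open>f\<close>-tension is
  \<open>d\<phi> (grad f)\<close>, and since \<open>2 \<nabla>\<^bsub>grad f\<^esub> grad f = grad \<bar>grad f\<bar>\<^sup>2\<close> by the symmetry of the
  Hessian, its bi-\<open>f\<close>-tension is \<open>-1/2 d\<phi>\<close> of the left-hand side of the equation. As \<open>d\<phi>\<close> is
  injective this proves the equivalence, and \<open>f\<close>-harmonicity would force \<open>grad f = 0\<close>.
\<close>

section \<open>Calculus of smooth maps\<close>

text \<open>The gradient and the Christoffel symbols are definite descriptions and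
  \<open>frame\<close> is a choice, so existence, and smoothness near the point, must be secured
  before anything can be differentiated: a finite-dimensional Riesz lemma gives the former, a smooth
  Gram-Schmidt frame the latter. The traces on the source and those along the map sum over the same
  \<open>frame G x\<close>, so they are compared term by term. A target chart
  \<open>warped_chart lam c' d\<close> may contain a base chart \<open>c'\<close> other than the
  source chart \<open>c\<close>. This is why a transition map appears in the coordinate expression
  of the inclusion, and why Christoffel symbols must be shown natural under isometries. A vanishing
  gradient makes \<open>f\<close> only locally constant; connectedness of \<open>M\<close> turns
  this into a contradiction.\<close>

lemma fderiv_cong:
  assumes "open W" "x \<in> W" "\<And>y. y \<in> W \<Longrightarrow> f y = g y"
  shows "fderiv f x = fderiv g x"
proof -
  \<comment> \<open>Both functions have the same candidates for a derivative, so the choice in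
    \<open>frechet_derivative\<close> agrees even where no derivative exists.\<close>
  have "(f has_derivative D) (at x) \<longleftrightarrow> (g has_derivative D) (at x)" for D
    using has_derivative_transform_within_open[OF _ assms(1,2), of f D UNIV g]
      has_derivative_transform_within_open[OF _ assms(1,2), of g D UNIV f] assms(3) by auto
  then show ?thesis unfolding frechet_derivative_def by simp
qed

lemma fderivI: "(f has_derivative D) (at x) \<Longrightarrow> fderiv f x v = D v"
  using frechet_derivative_at by metis

lemma differentiable_cong:
  assumes "open W" "x \<in> W" "\<And>y. y \<in> W \<Longrightarrow> f y = g y" "f differentiable at x"
  shows "g differentiable at x"
  using assms has_derivative_transform_within_open[OF _ assms(1,2)] unfolding differentiable_def
  by metis

text \<open>On an open set, equal values give equal germs, and therefore equal derivatives of every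
  order.\<close>

lemma cont_diff_on_cong:
  assumes "open S" "\<And>x. x \<in> S \<Longrightarrow> f x = g x" "cont_diff_on n S f"
  shows "cont_diff_on n S g"
  using assms(2,3)
proof (induction n arbitrary: f g)
  case 0
  then show ?case by (simp cong: continuous_on_cong)
next
  case (Suc n)
  have "g differentiable at x" if "x \<in> S" for x
    using differentiable_cong[OF assms(1) that Suc.prems(1)] Suc.prems(2) that by auto
  moreover have "cont_diff_on n S (\<lambda>x. fderiv g x v)" for v
    using Suc.IH[of "\<lambda>x. fderiv f x v" "\<lambda>x. fderiv g x v"] Suc.prems
      fderiv_cong[OF assms(1) _ Suc.prems(1)] by auto
  ultimately show ?case by simp
qed

lemma cont_diff_on_subset:
  "T \<subseteq> S \<Longrightarrow> cont_diff_on n S f \<Longrightarrow> cont_diff_on n T f"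
  by (induction n arbitrary: f) (auto intro: continuous_on_subset)

lemma cont_diff_on_SucD: "cont_diff_on (Suc n) S f \<Longrightarrow> cont_diff_on n S f"
proof (induction n arbitrary: f)
  case 0
  then show ?case
    using differentiable_imp_continuous_within[where s=UNIV]
    by (auto intro: continuous_at_imp_continuous_on)
next
  case (Suc n)
  then show ?case by (metis cont_diff_on.simps(2))
qed

lemma cont_diff_on_const: "cont_diff_on n S (\<lambda>x. c)"
  by (induction n arbitrary: c) simp_all

lemma cont_diff_on_blinear:
  assumes "open S" "bounded_linear L" "cont_diff_on n S f"
  shows "cont_diff_on n S (\<lambda>x. L (f x))"
  using assms(3)
proof (induction n arbitrary: f)
  case 0
  then show ?case using bounded_linear.continuous_on[OF assms(2)] by simp
next
  case (Suc n)
  have D: "((\<lambda>x. L (f x)) has_derivative (\<lambda>v. L (fderiv f x v))) (at x)" if "x \<in> S" for x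
    using Suc.prems that
    by (intro bounded_linear.has_derivative[OF assms(2)]) (simp add: frechet_derivative_works)
  have "cont_diff_on n S (\<lambda>x. fderiv (\<lambda>x. L (f x)) x v)" for v
  proof (rule cont_diff_on_cong[OF assms(1)])
    show "cont_diff_on n S (\<lambda>x. L (fderiv f x v))"
      using Suc.IH Suc.prems by simp
  qed (simp add: fderivI[OF D])
  with D show ?case by (auto simp: differentiable_def)
qed

lemma cont_diff_on_add:
  assumes "open S" "cont_diff_on n S f" "cont_diff_on n S g"
  shows "cont_diff_on n S (\<lambda>x. f x + g x)"
  using assms(2,3)
proof (induction n arbitrary: f g)
  case 0
  then show ?case by (simp add: continuous_on_add)
next
  case (Suc n)
  have D: "((\<lambda>x. f x + g x) has_derivative (\<lambda>v. fderiv f x v + fderiv g x v)) (at x)"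
    if "x \<in> S" for x
    using Suc.prems that by (intro has_derivative_add) (simp_all add: frechet_derivative_works)
  have "cont_diff_on n S (\<lambda>x. fderiv (\<lambda>x. f x + g x) x v)" for v
  proof (rule cont_diff_on_cong[OF assms(1)])
    show "cont_diff_on n S (\<lambda>x. fderiv f x v + fderiv g x v)"
      using Suc.IH Suc.prems by simp
  qed (simp add: fderivI[OF D])
  with D show ?case by (auto simp: differentiable_def)
qed

text \<open>The Leibniz rule leaves one factor undifferentiated in each term; that factor is lowered
  by one order before the induction hypothesis applies.\<close>

lemma cont_diff_on_bbilinear:
  assumes "open S" "bounded_bilinear B" "cont_diff_on n S f" "cont_diff_on n S g"
  shows "cont_diff_on n S (\<lambda>x. B (f x) (g x))"
  using assms(3,4)
proof (induction n arbitrary: f g)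
  case 0
  then show ?case by (simp add: bounded_bilinear.continuous_on[OF assms(2)])
next
  case (Suc n)
  have D: "((\<lambda>x. B (f x) (g x)) has_derivative
      (\<lambda>v. B (f x) (fderiv g x v) + B (fderiv f x v) (g x))) (at x)" if "x \<in> S" for x
    using Suc.prems that
    by (intro bounded_bilinear.FDERIV[OF assms(2)]) (simp_all add: frechet_derivative_works)
  have "cont_diff_on n S (\<lambda>x. fderiv (\<lambda>x. B (f x) (g x)) x v)" for v
  proof (rule cont_diff_on_cong[OF assms(1)])
    have "cont_diff_on n S f" "cont_diff_on n S g"
      using Suc.prems cont_diff_on_SucD by blast+
    then show "cont_diff_on n S (\<lambda>x. B (f x) (fderiv g x v) + B (fderiv f x v) (g x))"
      using Suc by (intro cont_diff_on_add[OF assms(1)]) auto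
  qed (simp add: fderivI[OF D])
  with D show ?case by (auto simp: differentiable_def)
qed

lemma cont_diff_on_sum:
  assumes "open S" "\<And>i. i \<in> I \<Longrightarrow> cont_diff_on n S (f i)"
  shows "cont_diff_on n S (\<lambda>x. \<Sum>i\<in>I. f i x)"
  using assms(2)
proof (induction I rule: infinite_finite_induct)
  case (insert a I)
  then show ?case by (simp add: cont_diff_on_add[OF assms(1)])
qed (simp_all add: cont_diff_on_const)

lemma linear_sum_Basis:
  fixes L :: "'a::euclidean_space \<Rightarrow> 'b::real_vector"
  assumes "linear L"
  shows "L v = (\<Sum>b\<in>Basis. (v \<bullet> b) *\<^sub>R L b)"
proof -
  have "L v = L (\<Sum>b\<in>Basis. (v \<bullet> b) *\<^sub>R b)" by (simp add: euclidean_representation)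
  also have "\<dots> = (\<Sum>b\<in>Basis. (v \<bullet> b) *\<^sub>R L b)"
    by (simp add: linear_sum[OF assms] linear_cmul[OF assms])
  finally show ?thesis .
qed

text \<open>In the chain rule \<open>fderiv g\<close> is taken in a direction that moves with
  \<open>x\<close>, while \<open>cont_diff_on\<close> speaks of fixed directions only. Expanding the
  moving direction in the standard basis of the middle space reduces to sums and products.\<close>

lemma cont_diff_on_compose:
  fixes f :: "'a::real_normed_vector \<Rightarrow> 'b::euclidean_space"
    and g :: "'b \<Rightarrow> 'c::real_normed_vector"
  assumes "open S" "f ` S \<subseteq> T" "cont_diff_on n S f" "cont_diff_on n T g"
  shows "cont_diff_on n S (\<lambda>x. g (f x))"
  using assms(3,4)
proof (induction n arbitrary: g)
  case 0
  then show ?case using continuous_on_compose2 assms(2) by auto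
next
  case (Suc n)
  have D: "((\<lambda>x. g (f x)) has_derivative (\<lambda>v. fderiv g (f x) (fderiv f x v))) (at x)"
    and lin: "linear (fderiv g (f x))" if "x \<in> S" for x
  proof -
    have "f differentiable at x" "g differentiable at (f x)" using Suc.prems assms(2) that by auto
    then show "((\<lambda>x. g (f x)) has_derivative (\<lambda>v. fderiv g (f x) (fderiv f x v))) (at x)"
      "linear (fderiv g (f x))"
      using diff_chain_at[of f "fderiv f x" x g "fderiv g (f x)"] linear_frechet_derivative
      by (auto simp: frechet_derivative_works o_def)
  qed
  have "cont_diff_on n S (\<lambda>x. fderiv (\<lambda>x. g (f x)) x v)" for v
  proof (rule cont_diff_on_cong[OF assms(1)])
    have "cont_diff_on n S f" using Suc.prems cont_diff_on_SucD by blast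
    then have "cont_diff_on n S (\<lambda>x. fderiv g (f x) b)" for b
      using Suc.IH[of "\<lambda>y. fderiv g y b"] Suc.prems by simp
    moreover have "cont_diff_on n S (\<lambda>x. fderiv f x v \<bullet> b)" for b
      using Suc.prems by (intro cont_diff_on_blinear[OF assms(1) bounded_linear_inner_left]) simp
    ultimately show
      "cont_diff_on n S (\<lambda>x. \<Sum>b\<in>Basis. (fderiv f x v \<bullet> b) *\<^sub>R fderiv g (f x) b)"
      by (intro cont_diff_on_sum[OF assms(1)]
          cont_diff_on_bbilinear[OF assms(1) bounded_bilinear_scaleR])
    show "(\<Sum>b\<in>Basis. (fderiv f x v \<bullet> b) *\<^sub>R fderiv g (f x) b) = fderiv (\<lambda>x. g (f x)) x v"
      if "x \<in> S" for x
      using linear_sum_Basis[OF lin[OF that], of "fderiv f x v"] by (simp add: fderivI[OF D] that)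
  qed
  with D show ?case by (auto simp: differentiable_def)
qed

lemma smooth_on_fderiv: "smooth_on S f \<Longrightarrow> smooth_on S (\<lambda>x. fderiv f x v)"
  unfolding smooth_on_def by (metis cont_diff_on.simps(2))

lemma smooth_on_differentiable: "smooth_on S f \<Longrightarrow> x \<in> S \<Longrightarrow> f differentiable at x"
  unfolding smooth_on_def by (metis cont_diff_on.simps(2))

lemma smooth_on_has_derivative:
  "smooth_on S f \<Longrightarrow> x \<in> S \<Longrightarrow> (f has_derivative fderiv f x) (at x)"
  using smooth_on_differentiable frechet_derivative_works by blast

lemma smooth_on_continuous: "smooth_on S f \<Longrightarrow> continuous_on S f"
  unfolding smooth_on_def by (metis cont_diff_on.simps(1))

lemma smooth_on_cong:
  "open S \<Longrightarrow> (\<And>x. x \<in> S \<Longrightarrow> f x = g x) \<Longrightarrow> smooth_on S f \<Longrightarrow> smooth_on S g"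
  unfolding smooth_on_def using cont_diff_on_cong by blast

lemma smooth_on_subset: "smooth_on S f \<Longrightarrow> T \<subseteq> S \<Longrightarrow> smooth_on T f"
  unfolding smooth_on_def using cont_diff_on_subset by blast

lemma smooth_on_const [simp]: "smooth_on S (\<lambda>x. c)"
  unfolding smooth_on_def using cont_diff_on_const by blast

lemma smooth_on_blinear:
  "open S \<Longrightarrow> bounded_linear L \<Longrightarrow> smooth_on S f \<Longrightarrow> smooth_on S (\<lambda>x. L (f x))"
  unfolding smooth_on_def using cont_diff_on_blinear by blast

lemma smooth_on_bbilinear:
  "open S \<Longrightarrow> bounded_bilinear B \<Longrightarrow> smooth_on S f \<Longrightarrow> smooth_on S g
    \<Longrightarrow> smooth_on S (\<lambda>x. B (f x) (g x))"
  unfolding smooth_on_def using cont_diff_on_bbilinear by blast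

lemmas smooth_on_scaleR = smooth_on_bbilinear[OF _ bounded_bilinear_scaleR]
lemmas smooth_on_mult = smooth_on_bbilinear[OF _ bounded_bilinear_mult]
lemmas smooth_on_inner_left = smooth_on_blinear[OF _ bounded_linear_inner_left]

lemma smooth_on_add:
  "open S \<Longrightarrow> smooth_on S f \<Longrightarrow> smooth_on S g \<Longrightarrow> smooth_on S (\<lambda>x. f x + g x)"
  unfolding smooth_on_def using cont_diff_on_add by blast

lemma smooth_on_diff:
  "open S \<Longrightarrow> smooth_on S f \<Longrightarrow> smooth_on S g \<Longrightarrow> smooth_on S (\<lambda>x. f x - g x)"
  unfolding diff_conv_add_uminus
  by (intro smooth_on_add smooth_on_blinear[where L = uminus]
      bounded_linear_minus[OF bounded_linear_ident])

lemma smooth_on_sum: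
  "open S \<Longrightarrow> (\<And>i. i \<in> I \<Longrightarrow> smooth_on S (f i)) \<Longrightarrow> smooth_on S (\<lambda>x. \<Sum>i\<in>I. f i x)"
  unfolding smooth_on_def using cont_diff_on_sum[of S I] by blast

lemma smooth_on_compose:
  fixes f :: "'a::real_normed_vector \<Rightarrow> 'b::euclidean_space"
  shows "open S \<Longrightarrow> f ` S \<subseteq> T \<Longrightarrow> smooth_on S f \<Longrightarrow> smooth_on T g
    \<Longrightarrow> smooth_on S (\<lambda>x. g (f x))"
  unfolding smooth_on_def using cont_diff_on_compose by blast

lemma smooth_on_Pair:
  assumes "open S" "smooth_on S f" "smooth_on S g"
  shows "smooth_on S (\<lambda>x. (f x, g x))"
proof -
  have "smooth_on S (\<lambda>x. (f x, 0) + (0, g x))"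
    using assms by (intro smooth_on_add smooth_on_blinear[of S "\<lambda>a. (a, 0)"]
        smooth_on_blinear[of S "\<lambda>b. (0, b)"] bounded_linear_Pair bounded_linear_ident
        bounded_linear_zero)
  then show ?thesis by simp
qed

lemma smooth_on_ident:
  assumes "open S" shows "smooth_on S (\<lambda>x. x)"
  unfolding smooth_on_def
proof
  show "cont_diff_on n S (\<lambda>x. x)" for n by (cases n) (auto simp: cont_diff_on_const)
qed

lemma smooth_on_linear:
  "open S \<Longrightarrow> bounded_linear L \<Longrightarrow> smooth_on S L"
  using smooth_on_blinear[OF _ _ smooth_on_ident] by blast

text \<open>Meant for the normalising factor with exponent \<open>- 1 / 2\<close> in Gram-Schmidt.
  The exponent is arbitrary because differentiation shifts it.\<close>

lemma smooth_on_powr: "smooth_on {0<..} (\<lambda>t::real. t powr a)"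
  unfolding smooth_on_def
proof
  fix n
  show "cont_diff_on n {0<..} (\<lambda>t::real. t powr a)"
  proof (induction n arbitrary: a)
    case 0
    then show ?case by (auto intro!: continuous_intros)
  next
    case (Suc n)
    have D: "((\<lambda>t. t powr a) has_derivative (\<lambda>v. v * (a * t powr (a - 1)))) (at t)"
      if "t \<in> {0<..}" for t :: real
      using has_real_derivative_powr[of t a] that unfolding has_field_derivative_def
      by (auto elim!: has_derivative_eq_rhs simp: fun_eq_iff)
    have "cont_diff_on n {0<..} (\<lambda>t. fderiv (\<lambda>t::real. t powr a) t v)" for v
    proof (rule cont_diff_on_cong[OF open_greaterThan])
      have "bounded_linear (\<lambda>s::real. v * (a * s))"
        by (intro bounded_linear_const_mult bounded_linear_ident)
      from cont_diff_on_blinear[OF open_greaterThan this Suc.IH]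
      show "cont_diff_on n {0<..} (\<lambda>t::real. v * (a * t powr (a - 1)))" .
    qed (simp add: fderivI[OF D])
    with D show ?case by (auto simp: differentiable_def)
  qed
qed

lemma linear_fderiv:
  assumes "smooth_on S f" "x \<in> S"
  shows "linear (fderiv f x)"
  using linear_frechet_derivative[OF smooth_on_differentiable[OF assms]] .

lemma smooth_on_fderiv_field:
  fixes f :: "'a::euclidean_space \<Rightarrow> 'b::real_normed_vector"
  assumes "open S" "smooth_on S f" "smooth_on S X"
  shows "smooth_on S (\<lambda>x. fderiv f x (X x))"
proof (rule smooth_on_cong[OF assms(1)])
  show "smooth_on S (\<lambda>x. \<Sum>b\<in>Basis. (X x \<bullet> b) *\<^sub>R fderiv f x b)"
    using assms by (intro smooth_on_sum smooth_on_scaleR smooth_on_inner_left smooth_on_fderiv)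
  show "(\<Sum>b\<in>Basis. (X x \<bullet> b) *\<^sub>R fderiv f x b) = fderiv f x (X x)" if "x \<in> S" for x
    by (rule linear_sum_Basis[OF linear_fderiv[OF assms(2) that], symmetric])
qed

section \<open>Symmetry of second derivatives\<close>

lemma mixed_difference_mvt:
  fixes f :: "'a::real_normed_vector \<Rightarrow> real"
  assumes S: "open S" "smooth_on S f"
    and s: "0 < s" and sub: "\<And>a b. 0 \<le> a \<Longrightarrow> a \<le> s \<Longrightarrow> 0 \<le> b \<Longrightarrow> b \<le> s \<Longrightarrow> x + a *\<^sub>R u + b *\<^sub>R v \<in> S"
  obtains a b where "0 \<le> a" "a \<le> s" "0 \<le> b" "b \<le> s"
    "f (x + s *\<^sub>R u + s *\<^sub>R v) - f (x + s *\<^sub>R u) - (f (x + s *\<^sub>R v) - f x)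
      = s * s * fderiv (\<lambda>y. fderiv f y u) (x + a *\<^sub>R u + b *\<^sub>R v) v"
proof -
  have line: "((\<lambda>t. g (p + t *\<^sub>R w)) has_real_derivative fderiv g (p + t *\<^sub>R w) w) (at t)"
    if "smooth_on S g" "p + t *\<^sub>R w \<in> S" for g :: "'a \<Rightarrow> real" and p w t
  proof -
    have "((\<lambda>t. p + t *\<^sub>R w) has_derivative (\<lambda>h. h *\<^sub>R w)) (at t)"
      by (auto intro!: derivative_eq_intros)
    from diff_chain_at[OF this smooth_on_has_derivative[OF that]]
    have "((\<lambda>t. g (p + t *\<^sub>R w)) has_derivative (\<lambda>h. fderiv g (p + t *\<^sub>R w) (h *\<^sub>R w))) (at t)"
      by (simp add: o_def)
    then show ?thesis
      unfolding has_field_derivative_def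
      by (rule has_derivative_eq_rhs) (simp add: linear_cmul[OF linear_fderiv[OF that]] fun_eq_iff)
  qed
  \<comment> \<open>The second difference is the increment, as \<open>t\<close> runs from
    \<open>0\<close> to \<open>s\<close>, of a first difference in direction \<open>v\<close>. The
    mean value theorem is used on it in direction \<open>u\<close>, then once more in direction
    \<open>v\<close>.\<close>
  have "((\<lambda>t. f ((x + s *\<^sub>R v) + t *\<^sub>R u) - f (x + t *\<^sub>R u)) has_real_derivative
      (fderiv f (x + s *\<^sub>R v + t *\<^sub>R u) u - fderiv f (x + t *\<^sub>R u) u)) (at t)"
    if "0 \<le> t" "t \<le> s" for t
    using sub[of t s] sub[of t 0] that s
    by (intro DERIV_diff line S) (simp_all add: algebra_simps)
  from MVT2[OF s this] obtain a where a: "0 < a" "a < s"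
    "f ((x + s *\<^sub>R v) + s *\<^sub>R u) - f (x + s *\<^sub>R u) - (f (x + s *\<^sub>R v) - f x)
      = s * (fderiv f (x + s *\<^sub>R v + a *\<^sub>R u) u - fderiv f (x + a *\<^sub>R u) u)"
    by auto
  have "((\<lambda>t. fderiv f ((x + a *\<^sub>R u) + t *\<^sub>R v) u) has_real_derivative
      fderiv (\<lambda>y. fderiv f y u) (x + a *\<^sub>R u + t *\<^sub>R v) v) (at t)"
    if "0 \<le> t" "t \<le> s" for t
    using sub[of a t] that a by (intro line smooth_on_fderiv S) auto
  from MVT2[OF s this] obtain b where b: "0 < b" "b < s"
    "fderiv f (x + a *\<^sub>R u + s *\<^sub>R v) u - fderiv f (x + a *\<^sub>R u) u
      = s * fderiv (\<lambda>y. fderiv f y u) (x + a *\<^sub>R u + b *\<^sub>R v) v"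
    by auto
  show thesis
    using a b by (intro that[of a b]) (simp_all add: algebra_simps)
qed

text \<open>One second difference over a small parallelogram equals \<open>s * s\<close> times
  either iterated derivative, each at some point of the parallelogram; continuity at
  \<open>x\<close> then excludes different values.\<close>

lemma fderiv_commute_real:
  fixes f :: "'a::real_normed_vector \<Rightarrow> real"
  assumes S: "open S" "smooth_on S f" and x: "x \<in> S"
  shows "fderiv (\<lambda>y. fderiv f y u) x v = fderiv (\<lambda>y. fderiv f y v) x u"
proof (rule ccontr)
  define P where "P y = fderiv (\<lambda>y. fderiv f y u) y v" for y
  define Q where "Q y = fderiv (\<lambda>y. fderiv f y v) y u" for y
  assume "\<not> ?thesis"
  then have "P x \<noteq> Q x" by (simp add: P_def Q_def)
  \<comment> \<open>Half the distance: a single number cannot be this close to both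
    \<open>P x\<close> and \<open>Q x\<close>.\<close>
  then have e: "dist (P x) (Q x) / 2 > 0" (is "?e > 0") by simp
  have "continuous_on S P" "continuous_on S Q"
    unfolding P_def Q_def using S by (auto intro!: smooth_on_continuous smooth_on_fderiv)
  then have "isCont P x" "isCont Q x"
    using S(1) x continuous_on_eq_continuous_at by blast+
  then obtain d1 d2 where d: "d1 > 0" "\<And>y. dist y x < d1 \<Longrightarrow> dist (P y) (P x) < ?e"
      "d2 > 0" "\<And>y. dist y x < d2 \<Longrightarrow> dist (Q y) (Q x) < ?e"
    using e unfolding continuous_at_eps_delta by metis
  obtain d3 where d3: "d3 > 0" "ball x d3 \<subseteq> S" using S(1) x openE by blast
  define d where "d = min d1 (min d2 d3)"
  have "d > 0" using d d3 by (simp add: d_def)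
  \<comment> \<open>The side length keeps the whole parallelogram within distance
    \<open>d / 2\<close> of \<open>x\<close>; the summand \<open>1\<close> covers
    \<open>u = v = 0\<close>.\<close>
  define s where "s = d / 2 / (norm u + norm v + 1)"
  have pos: "norm u + norm v + 1 > 0" using norm_ge_zero[of u] norm_ge_zero[of v] by linarith
  have s: "s > 0" using \<open>d > 0\<close> pos by (simp add: s_def)
  have near: "dist (x + a *\<^sub>R u + b *\<^sub>R v) x < d"
    if "0 \<le> a" "a \<le> s" "0 \<le> b" "b \<le> s" for a b
  proof -
    have "dist (x + a *\<^sub>R u + b *\<^sub>R v) x \<le> norm (a *\<^sub>R u) + norm (b *\<^sub>R v)"
      using norm_triangle_ineq[of "a *\<^sub>R u" "b *\<^sub>R v"] by (simp add: dist_norm algebra_simps)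
    also have "\<dots> \<le> s * norm u + s * norm v"
      using that by (simp add: add_mono mult_right_mono)
    also have "\<dots> \<le> s * (norm u + norm v + 1)" using s by (simp add: algebra_simps)
    also have "\<dots> = d / 2" unfolding s_def using pos by (metis less_irrefl nonzero_eq_divide_eq)
    also have "\<dots> < d" using \<open>d > 0\<close> by simp
    finally show ?thesis .
  qed
  have sub: "x + a *\<^sub>R u + b *\<^sub>R v \<in> S" if "0 \<le> a" "a \<le> s" "0 \<le> b" "b \<le> s" for a b
    using near[OF that] d3(2) by (auto simp: d_def dist_commute subset_iff)
  \<comment> \<open>The same parallelogram with its sides exchanged, for the second use of the mean
    value lemma.\<close>
  have sub': "x + a *\<^sub>R v + b *\<^sub>R u \<in> S" if "0 \<le> a" "a \<le> s" "0 \<le> b" "b \<le> s" for a b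
    using sub[of b a] that by (simp add: algebra_simps)
  obtain a b where ab: "0 \<le> a" "a \<le> s" "0 \<le> b" "b \<le> s"
    "f (x + s *\<^sub>R u + s *\<^sub>R v) - f (x + s *\<^sub>R u) - (f (x + s *\<^sub>R v) - f x)
      = s * s * P (x + a *\<^sub>R u + b *\<^sub>R v)"
    using mixed_difference_mvt[OF S s sub] unfolding P_def by blast
  obtain a' b' where ab': "0 \<le> a'" "a' \<le> s" "0 \<le> b'" "b' \<le> s"
    "f (x + s *\<^sub>R v + s *\<^sub>R u) - f (x + s *\<^sub>R v) - (f (x + s *\<^sub>R u) - f x)
      = s * s * Q (x + a' *\<^sub>R v + b' *\<^sub>R u)"
    using mixed_difference_mvt[OF S s sub'] unfolding Q_def by blast
  have "x + s *\<^sub>R v + s *\<^sub>R u = x + s *\<^sub>R u + s *\<^sub>R v" by simp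
  then have "s * s * P (x + a *\<^sub>R u + b *\<^sub>R v) = s * s * Q (x + a' *\<^sub>R v + b' *\<^sub>R u)"
    using ab(5) ab'(5) by (simp only:)
  then have "P (x + a *\<^sub>R u + b *\<^sub>R v) = Q (x + b' *\<^sub>R u + a' *\<^sub>R v)"
    using s by (simp add: algebra_simps)
  moreover have "dist (P (x + a *\<^sub>R u + b *\<^sub>R v)) (P x) < ?e"
    using near[of a b] ab by (intro d(2)) (simp add: d_def)
  moreover have "dist (Q (x + b' *\<^sub>R u + a' *\<^sub>R v)) (Q x) < ?e"
    using near[of b' a'] ab' by (intro d(4)) (simp add: d_def)
  ultimately show False
    using dist_triangle3[of "P x" "Q x" "P (x + a *\<^sub>R u + b *\<^sub>R v)"] by simp
qed

lemma fderiv_commute: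
  fixes f :: "'a::real_normed_vector \<Rightarrow> 'b::euclidean_space"
  assumes S: "open S" "smooth_on S f" and x: "x \<in> S"
  shows "fderiv (\<lambda>y. fderiv f y u) x v = fderiv (\<lambda>y. fderiv f y v) x u"
proof (rule euclidean_eqI)
  fix b :: 'b assume "b \<in> Basis"
  have inner: "fderiv (\<lambda>y. g y \<bullet> b) y w = fderiv g y w \<bullet> b"
    if "smooth_on S g" "y \<in> S" for g :: "'a \<Rightarrow> 'b" and y w
    by (rule fderivI, rule bounded_linear.has_derivative[OF bounded_linear_inner_left
        smooth_on_has_derivative[OF that]])
  have "fderiv (\<lambda>y. fderiv f y u) x v \<bullet> b = fderiv (\<lambda>y. fderiv (\<lambda>y. f y \<bullet> b) y u) x v" for u v
  proof -
    have "fderiv (\<lambda>y. fderiv f y u) x v \<bullet> b = fderiv (\<lambda>y. fderiv f y u \<bullet> b) x v"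
      by (rule inner[OF smooth_on_fderiv[OF S(2)] x, symmetric])
    also have "\<dots> = fderiv (\<lambda>y. fderiv (\<lambda>y. f y \<bullet> b) y u) x v"
      by (rule arg_cong2[where f = "\<lambda>D. D", OF fderiv_cong[OF S(1) x] refl])
        (rule inner[OF S(2), symmetric])
    finally show ?thesis .
  qed
  then show "fderiv (\<lambda>y. fderiv f y u) x v \<bullet> b = fderiv (\<lambda>y. fderiv f y v) x u \<bullet> b"
    by (simp only: fderiv_commute_real[OF S(1) smooth_on_inner_left[OF S] x, of b u v])
qed

section \<open>Fields of bilinear forms\<close>

lemma bilinear_sum_Basis:
  fixes B :: "'a::euclidean_space \<Rightarrow> 'b::euclidean_space \<Rightarrow> 'c::real_vector"
  assumes "bilinear B"
  shows "B u v = (\<Sum>i\<in>Basis. \<Sum>j\<in>Basis. ((u \<bullet> i) * (v \<bullet> j)) *\<^sub>R B i j)"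
proof -
  have "B u v = (\<Sum>i\<in>Basis. (u \<bullet> i) *\<^sub>R B i v)"
    using linear_sum_Basis[of "\<lambda>u. B u v" u] assms by (simp add: bilinear_def)
  also have "\<dots> = (\<Sum>i\<in>Basis. (u \<bullet> i) *\<^sub>R (\<Sum>j\<in>Basis. (v \<bullet> j) *\<^sub>R B i j))"
    using linear_sum_Basis[of "B _" v] assms by (intro sum.cong refl arg_cong2[where f = scaleR])
      (simp_all add: bilinear_def)
  finally show ?thesis by (simp add: scaleR_sum_right)
qed

text \<open>Treats together the metric, the Christoffel symbols, their pull-backs along a map and
  the differential of a map, wherever the base point and both arguments move at once.\<close>

locale bilinear_field =
  fixes S :: "'s::real_normed_vector set"
    and B :: "'s \<Rightarrow> 'a::euclidean_space \<Rightarrow> 'b::euclidean_space \<Rightarrow> 'c::real_normed_vector"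
  assumes open_dom: "open S"
    and bil: "x \<in> S \<Longrightarrow> bilinear (B x)"
    and smooth: "smooth_on S (\<lambda>x. B x a b)"
begin

lemma smooth_on_apply:
  assumes "open W" "W \<subseteq> S" "smooth_on W u" "smooth_on W v"
  shows "smooth_on W (\<lambda>x. B x (u x) (v x))"
proof (rule smooth_on_cong[OF assms(1)])
  show "smooth_on W (\<lambda>x. \<Sum>i\<in>Basis. \<Sum>j\<in>Basis. ((u x \<bullet> i) * (v x \<bullet> j)) *\<^sub>R B x i j)"
    using assms(1)
    by (intro smooth_on_sum smooth_on_scaleR smooth_on_mult smooth_on_inner_left assms
        smooth_on_subset[OF smooth assms(2)])
  show "(\<Sum>i\<in>Basis. \<Sum>j\<in>Basis. ((u x \<bullet> i) * (v x \<bullet> j)) *\<^sub>R B x i j) = B x (u x) (v x)"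
    if "x \<in> W" for x
    using bilinear_sum_Basis[OF bil[of x], of "u x" "v x"] that assms(2) by auto
qed

text \<open>A product rule with three moving parts. In components it is the ordinary product rule;
  the work lies in recognising the sum over differentiated components as the derivative with frozen
  arguments.\<close>

lemma has_derivative_apply:
  assumes x: "x \<in> S" and u: "(u has_derivative u') (at x)" and v: "(v has_derivative v') (at x)"
  shows "((\<lambda>y. B y (u y) (v y)) has_derivative
    (\<lambda>h. fderiv (\<lambda>y. B y (u x) (v x)) x h + B x (u' h) (v x) + B x (u x) (v' h))) (at x)"
proof -
  have D: "((\<lambda>y. B y (u y) (v y)) has_derivative
      (\<lambda>h. \<Sum>i\<in>Basis. \<Sum>j\<in>Basis. ((u x \<bullet> i) * (v x \<bullet> j)) *\<^sub>R fderiv (\<lambda>y. B y i j) x h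
        + ((u x \<bullet> i) * (v' h \<bullet> j) + (u' h \<bullet> i) * (v x \<bullet> j)) *\<^sub>R B x i j)) (at x)"
    if u: "(u has_derivative u') (at x)" and v: "(v has_derivative v') (at x)" for u v u' v'
  proof (rule has_derivative_transform_within_open[OF _ open_dom x])
    show "((\<lambda>y. \<Sum>i\<in>Basis. \<Sum>j\<in>Basis. ((u y \<bullet> i) * (v y \<bullet> j)) *\<^sub>R B y i j) has_derivative
      (\<lambda>h. \<Sum>i\<in>Basis. \<Sum>j\<in>Basis. ((u x \<bullet> i) * (v x \<bullet> j)) *\<^sub>R fderiv (\<lambda>y. B y i j) x h
        + ((u x \<bullet> i) * (v' h \<bullet> j) + (u' h \<bullet> i) * (v x \<bullet> j)) *\<^sub>R B x i j)) (at x)"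
      by (intro has_derivative_sum has_derivative_scaleR has_derivative_mult
          bounded_linear.has_derivative[OF bounded_linear_inner_left] u v
          smooth_on_has_derivative[OF smooth x])
    show "(\<Sum>i\<in>Basis. \<Sum>j\<in>Basis. ((u y \<bullet> i) * (v y \<bullet> j)) *\<^sub>R B y i j) = B y (u y) (v y)"
      if "y \<in> S" for y
      using bilinear_sum_Basis[OF bil[OF that], of "u y" "v y"] by simp
  qed
  \<comment> \<open>\<open>D\<close> is specialised to constant fields, for which only the
    derivatives of the components survive.\<close>
  have "fderiv (\<lambda>y. B y (u x) (v x)) x h
      = (\<Sum>i\<in>Basis. \<Sum>j\<in>Basis. ((u x \<bullet> i) * (v x \<bullet> j)) *\<^sub>R fderiv (\<lambda>y. B y i j) x h)" for h
    using fderivI[OF D[OF has_derivative_const has_derivative_const], of "u x" "v x" h] by simp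
  moreover have "(\<Sum>i\<in>Basis. \<Sum>j\<in>Basis. ((u x \<bullet> i) * (v x \<bullet> j)) *\<^sub>R fderiv (\<lambda>y. B y i j) x h
        + ((u x \<bullet> i) * (v' h \<bullet> j) + (u' h \<bullet> i) * (v x \<bullet> j)) *\<^sub>R B x i j)
     = (\<Sum>i\<in>Basis. \<Sum>j\<in>Basis. ((u x \<bullet> i) * (v x \<bullet> j)) *\<^sub>R fderiv (\<lambda>y. B y i j) x h)
       + B x (u' h) (v x) + B x (u x) (v' h)" for h
    unfolding bilinear_sum_Basis[OF bil[OF x], of "u' h"]
      bilinear_sum_Basis[OF bil[OF x], of "u x" "v' h"]
    by (simp add: sum.distrib scaleR_add_left ac_simps)
  ultimately show ?thesis using D[OF u v] by simp
qed

lemmas fderiv_apply = fderivI[OF has_derivative_apply]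

text \<open>The linearity identities hold throughout the open set \<open>S\<close> and may be
  differentiated. This makes the Koszul expression linear in each of its vectors.\<close>

lemma bilinear_fderiv:
  assumes x: "x \<in> S"
  shows "bilinear (\<lambda>a b. fderiv (\<lambda>y. B y a b) x h)"
proof -
  have lin: "linear (B y a)" "linear (\<lambda>a. B y a b)" if "y \<in> S" for y a b
    using bil[OF that] by (auto simp: bilinear_def)
  note D = smooth_on_has_derivative[OF smooth x]
  have eq: "fderiv f x h = D h" if "(g has_derivative D) (at x)" "\<And>y. y \<in> S \<Longrightarrow> g y = f y"
    for f g D
    using fderivI[OF has_derivative_transform_within_open[OF that(1) open_dom x that(2)]] .
  have "linear (\<lambda>b. fderiv (\<lambda>y. B y a b) x h)" for a
  proof (rule linearI)
    show "fderiv (\<lambda>y. B y a (p + q)) x h = fderiv (\<lambda>y. B y a p) x h + fderiv (\<lambda>y. B y a q) x h"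
      for p q
      by (rule eq[OF has_derivative_add[OF D D]]) (simp add: linear_add[OF lin(1)])
    show "fderiv (\<lambda>y. B y a (c *\<^sub>R p)) x h = c *\<^sub>R fderiv (\<lambda>y. B y a p) x h" for c p
      by (rule eq[OF has_derivative_scaleR_right[OF D]]) (simp add: linear_cmul[OF lin(1)])
  qed
  moreover have "linear (\<lambda>a. fderiv (\<lambda>y. B y a b) x h)" for b
  proof (rule linearI)
    show "fderiv (\<lambda>y. B y (p + q) b) x h = fderiv (\<lambda>y. B y p b) x h + fderiv (\<lambda>y. B y q b) x h"
      for p q
      by (rule eq[OF has_derivative_add[OF D D]]) (simp add: linear_add[OF lin(2)])
    show "fderiv (\<lambda>y. B y (c *\<^sub>R p) b) x h = c *\<^sub>R fderiv (\<lambda>y. B y p b) x h" for c p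
      by (rule eq[OF has_derivative_scaleR_right[OF D]]) (simp add: linear_cmul[OF lin(2)])
  qed
  ultimately show ?thesis by (simp add: bilinear_def)
qed

end

text \<open>Riesz representation: definiteness makes \<open>w \<mapsto> g w\<close> injective, and
  equality of finite dimensions makes it surjective. It justifies the definite descriptions in
  \<open>gradient\<close> and \<open>christoffel\<close>.\<close>

lemma inner_product_representation:
  fixes g :: "'a::euclidean_space \<Rightarrow> 'a \<Rightarrow> real"
  assumes g: "bilinear g" "\<And>u. u \<noteq> 0 \<Longrightarrow> g u u > 0" and l: "linear l"
  shows "\<exists>!w. \<forall>z. g w z = l z"
proof -
  have lin: "linear (g w)" "linear (\<lambda>w. g w z)" for w z using g(1) by (auto simp: bilinear_def)
  have zero: "w = 0" if "\<forall>z. g w z = 0" for w using g(2)[of w] that by force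
  \<comment> \<open>The functional \<open>g w\<close> is encoded as the vector of its values on the
    standard basis, so that injective implies surjective for an endomorphism.\<close>
  define A where "A w = (\<Sum>b\<in>Basis. g w b *\<^sub>R b)" for w
  have A: "A w \<bullet> b = g w b" if "b \<in> Basis" for w b
    using that by (simp add: A_def inner_sum_left inner_Basis if_distrib[where f = "\<lambda>t. _ * t"]
        cong: if_cong)
  have "linear A"
    unfolding A_def by (intro linearI)
      (simp_all add: linear_add[OF lin(2)] linear_cmul[OF lin(2)] sum.distrib scaleR_add_left
        scaleR_sum_right)
  moreover have "inj A"
  proof (subst linear_injective_0[OF \<open>linear A\<close>], intro allI impI zero)
    fix w z assume "A w = 0"
    then have "g w b = 0" if "b \<in> Basis" for b using A[OF that, of w] by simp
    then show "g w z = 0" using linear_sum_Basis[OF lin(1), of w z] by simp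
  qed
  ultimately have "surj A" using linear_injective_imp_surjective by blast
  then obtain w where w: "A w = (\<Sum>b\<in>Basis. l b *\<^sub>R b)" by (metis surj_def)
  have "g w b = l b" if "b \<in> Basis" for b
    using A[OF that, of w] that unfolding w
    by (simp add: inner_sum_left inner_Basis if_distrib[where f = "\<lambda>t. _ * t"] cong: if_cong)
  then have "g w z = l z" for z
    using linear_sum_Basis[OF lin(1), of w z] linear_sum_Basis[OF l, of z] by simp
  moreover have "w' = w''" if "\<forall>z. g w' z = l z" "\<forall>z. g w'' z = l z" for w' w''
    using zero[of "w' - w''"] that by (simp add: linear_diff[OF lin(2)])
  ultimately show ?thesis by blast
qed


section \<open>The Levi-Civita connection in a coordinate domain\<close>

locale riemannian_domain =
  fixes S :: "'e::euclidean_space set" and G :: "'e metric_field"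
  assumes open_S: "open S" and metric: "riemannian_metric_on S G"
begin

sublocale bilinear_field S G
  using open_S metric by unfold_locales (auto simp: riemannian_metric_on_def)

lemma sym: "x \<in> S \<Longrightarrow> G x u v = G x v u"
  using metric by (auto simp: riemannian_metric_on_def)

lemma pos: "x \<in> S \<Longrightarrow> u \<noteq> 0 \<Longrightarrow> G x u u > 0"
  using metric by (auto simp: riemannian_metric_on_def)

lemma linear_G: "x \<in> S \<Longrightarrow> linear (G x u)" "x \<in> S \<Longrightarrow> linear (\<lambda>u. G x u v)"
  using bil[of x] by (auto simp: bilinear_def)

lemmas G_simps =
  linear_add[OF linear_G(1)] linear_add[OF linear_G(2)]
  linear_diff[OF linear_G(1)] linear_diff[OF linear_G(2)]
  linear_cmul[OF linear_G(1)] linear_cmul[OF linear_G(2)]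
  linear_0[OF linear_G(1)] linear_0[OF linear_G(2)]
  linear_sum[OF linear_G(1)] linear_sum[OF linear_G(2)]

lemma nondegenerate: "x \<in> S \<Longrightarrow> (\<And>z. G x w z = G x w' z) \<Longrightarrow> w = w'"
  using pos[of x "w - w'"] by (force simp: G_simps)

lemma representation: "x \<in> S \<Longrightarrow> linear l \<Longrightarrow> \<exists>!w. \<forall>z. G x w z = l z"
  by (intro inner_product_representation bil pos)

lemma gradient_spec:
  assumes "x \<in> S" "F differentiable at x"
  shows "G x (gradient G F x) z = fderiv F x z"
  using theI'[OF representation[OF assms(1) linear_frechet_derivative[OF assms(2)]]]
  unfolding gradient_def by blast

lemma gradient_eqI:
  assumes "x \<in> S" "\<And>z. G x w z = fderiv F x z"
  shows "gradient G F x = w"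
  unfolding gradient_def
proof (rule the_equality)
  show "w' = w" if "\<forall>z. G x w' z = fderiv F x z" for w'
    using assms that by (intro nondegenerate[OF assms(1)]) simp
qed (use assms in simp)

lemma christoffel_spec:
  assumes x: "x \<in> S"
  shows "2 * G x (christoffel G x u v) z =
    fderiv (\<lambda>y. G y v z) x u + fderiv (\<lambda>y. G y u z) x v - fderiv (\<lambda>y. G y u v) x z" (is "_ = ?k z")
proof -
  have "linear (\<lambda>z. fderiv (\<lambda>y. G y v z) x u)" "linear (\<lambda>z. fderiv (\<lambda>y. G y u z) x v)"
    "linear (fderiv (\<lambda>y. G y u v) x)"
    using bilinear_fderiv[OF x] linear_fderiv[OF smooth x] by (auto simp: bilinear_def)
  then have "linear (\<lambda>z. inverse 2 *\<^sub>R ?k z)"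
    by (intro linear_compose_scale_right linear_compose_add linear_compose_sub)
  from representation[OF x this] have "\<exists>!w. \<forall>z. 2 * G x w z = ?k z"
    by (simp add: field_simps)
  from theI'[OF this] show ?thesis unfolding christoffel_def by blast
qed

lemma christoffel_eqI:
  assumes x: "x \<in> S" and "\<And>z. 2 * G x w z =
    fderiv (\<lambda>y. G y v z) x u + fderiv (\<lambda>y. G y u z) x v - fderiv (\<lambda>y. G y u v) x z"
  shows "christoffel G x u v = w"
proof (rule nondegenerate[OF x])
  show "G x (christoffel G x u v) z = G x w z" for z
    using christoffel_spec[OF x, of u v z] assms(2)[of z] by simp
qed

text \<open>Torsion-freeness: exchanging \<open>u\<close> and \<open>v\<close> swaps the first two
  Koszul terms, and symmetry of the metric near \<open>x\<close> preserves the third.\<close>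

lemma christoffel_sym: "x \<in> S \<Longrightarrow> christoffel G x u v = christoffel G x v u"
proof (rule christoffel_eqI)
  assume x: "x \<in> S"
  have "fderiv (\<lambda>y. G y v u) x = fderiv (\<lambda>y. G y u v) x"
    by (rule fderiv_cong[OF open_S x]) (rule sym)
  then show "2 * G x (christoffel G x v u) z =
      fderiv (\<lambda>y. G y v z) x u + fderiv (\<lambda>y. G y u z) x v - fderiv (\<lambda>y. G y u v) x z" for z
    using christoffel_spec[OF x, of v u z] by simp
qed

text \<open>Linearity in the second slot follows from uniqueness of the Koszul solution, and in the
  first slot from symmetry.\<close>

lemma bilinear_christoffel:
  assumes x: "x \<in> S"
  shows "bilinear (christoffel G x)"
proof -
  note lin = bilinear_fderiv[OF x, unfolded bilinear_def] linear_fderiv[OF smooth x]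
  note simps = linear_add[OF lin(1)[THEN conjunct1, THEN spec]]
    linear_add[OF lin(1)[THEN conjunct2, THEN spec]] linear_add[OF lin(2)]
    linear_cmul[OF lin(1)[THEN conjunct1, THEN spec]]
    linear_cmul[OF lin(1)[THEN conjunct2, THEN spec]] linear_cmul[OF lin(2)]
  have *: "linear (christoffel G x u)" for u
  proof (rule linearI; rule christoffel_eqI[OF x])
    show "2 * G x (christoffel G x u p + christoffel G x u q) z =
      fderiv (\<lambda>y. G y (p + q) z) x u + fderiv (\<lambda>y. G y u z) x (p + q)
      - fderiv (\<lambda>y. G y u (p + q)) x z" for p q z
      using christoffel_spec[OF x, of u p z] christoffel_spec[OF x, of u q z]
      by (simp add: simps G_simps x)
    show "2 * G x (c *\<^sub>R christoffel G x u p) z =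
      fderiv (\<lambda>y. G y (c *\<^sub>R p) z) x u + fderiv (\<lambda>y. G y u z) x (c *\<^sub>R p)
      - fderiv (\<lambda>y. G y u (c *\<^sub>R p)) x z" for c p z
      using arg_cong[OF christoffel_spec[OF x, of u p z], of "\<lambda>t. c * t"]
      by (simp add: simps G_simps x algebra_simps)
  qed
  moreover have "linear (\<lambda>u. christoffel G x u v)" for v
    using *[of v] christoffel_sym[OF x, of _ v] by simp
  ultimately show ?thesis by (simp add: bilinear_def)
qed

end

section \<open>Local orthonormal frames\<close>

lemma exists_not_in_span:
  fixes A :: "'a::euclidean_space set"
  assumes "finite A" "card A < DIM('a)"
  obtains v where "v \<notin> span A"
proof -
  have "dim A \<le> card A" using dim_le_card'[OF assms(1)] .
  then have "span A \<noteq> UNIV" using assms(2) dim_eq_full[of A] by linarith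
  then show thesis using that by blast
qed

text \<open>Exposes the neighbourhood hidden in \<open>orthonormal_frame_near\<close>, so that it
  can be shrunk and used as a domain of smoothness.\<close>

definition orthonormal_frame_on ::
  "'e::euclidean_space metric_field \<Rightarrow> 'e set \<Rightarrow> ('e \<Rightarrow> 'e \<Rightarrow> 'e) \<Rightarrow> bool" where
  "orthonormal_frame_on G W e \<longleftrightarrow> (\<forall>j\<in>Basis. smooth_on W (e j)) \<and>
     (\<forall>y\<in>W. \<forall>i\<in>Basis. \<forall>j\<in>Basis. G y (e i y) (e j y) = (if i = j then 1 else 0))"

context riemannian_domain
begin

text \<open>Gram-Schmidt one vector at a time. Any vector outside the span at \<open>x\<close> extends the family,
  and it stays outside of it near \<open>x\<close>.\<close>

lemma partial_frame:
  assumes x: "x \<in> S" and "finite A" "A \<subseteq> (Basis :: 'e set)"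
  shows "\<exists>W e. open W \<and> x \<in> W \<and> W \<subseteq> S \<and> (\<forall>j\<in>A. smooth_on W (e j)) \<and>
     (\<forall>y\<in>W. \<forall>i\<in>A. \<forall>j\<in>A. G y (e i y) (e j y) = (if i = j then 1 else 0))"
  using assms(2,3)
proof (induction A rule: finite_induct)
  case empty
  then show ?case using open_S x by blast
next
  case (insert a A)
  from insert.IH insert.prems obtain W e
    where W: "open W" "x \<in> W" "W \<subseteq> S" and e: "\<And>j. j \<in> A \<Longrightarrow> smooth_on W (e j)"
    and on: "\<And>y i j. y \<in> W \<Longrightarrow> i \<in> A \<Longrightarrow> j \<in> A \<Longrightarrow> G y (e i y) (e j y) = (if i = j then 1 else 0)"
    by (metis insert_subset)
  have "card A < DIM('e)"
    using insert.hyps insert.prems by (intro psubset_card_mono finite_Basis) auto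
  then have "card ((\<lambda>i. e i x) ` A) < DIM('e)"
    using card_image_le[OF insert(1), of "\<lambda>i. e i x"] by linarith
  then obtain v where v: "v \<notin> span ((\<lambda>i. e i x) ` A)"
    using exists_not_in_span[of "(\<lambda>i. e i x) ` A"] insert(1) by auto
  \<comment> \<open>The constant field \<open>v\<close> minus its orthogonal projection to the span
    of the fields found so far.\<close>
  define w where "w y = v - (\<Sum>i\<in>A. G y v (e i y) *\<^sub>R e i y)" for y
  have orth: "G y (w y) (e j y) = 0" if "y \<in> W" "j \<in> A" for y j
  proof -
    have "y \<in> S" using that W by blast
    then have "G y (w y) (e j y) = G y v (e j y) - (\<Sum>i\<in>A. G y v (e i y) * G y (e i y) (e j y))"
      by (simp add: w_def G_simps)
    also have "\<dots> = 0"
      using that insert(1) by (simp add: on if_distrib[where f = "\<lambda>t. _ * t"] cong: if_cong)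
    finally show ?thesis .
  qed
  have "smooth_on W w"
    unfolding w_def using W
    by (intro smooth_on_diff smooth_on_const smooth_on_sum smooth_on_scaleR smooth_on_apply e) auto
  define N where "N y = G y (w y) (w y)" for y
  have N: "smooth_on W N"
    unfolding N_def using W \<open>smooth_on W w\<close> by (intro smooth_on_apply)
  define W' where "W' = W \<inter> N -` {0<..}"
  have W': "open W'" "W' \<subseteq> W" "\<And>y. y \<in> W' \<Longrightarrow> N y > 0"
    using continuous_open_preimage[OF smooth_on_continuous[OF N] W(1) open_greaterThan]
    by (auto simp: W'_def)
  have "w x \<noteq> 0"
  proof
    assume "w x = 0"
    then have "v = (\<Sum>i\<in>A. G x v (e i x) *\<^sub>R e i x)" by (simp add: w_def)
    also have "\<dots> \<in> span ((\<lambda>i. e i x) ` A)"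
      by (intro span_sum span_scale span_base) auto
    finally show False using v by simp
  qed
  then have "x \<in> W'" using W x pos by (simp add: W'_def N_def)
  define e' where "e' j = (if j = a then \<lambda>y. N y powr (- 1 / 2) *\<^sub>R w y else e j)" for j
  have "smooth_on W' (\<lambda>y. N y powr (- 1 / 2))"
    using W' by (intro smooth_on_compose[OF W'(1) _ smooth_on_subset[OF N] smooth_on_powr]) auto
  then have "smooth_on W' (e' j)" if "j \<in> insert a A" for j
    using that W' \<open>smooth_on W w\<close> e
    by (auto simp: e'_def intro!: smooth_on_scaleR intro: smooth_on_subset)
  moreover have "G y (e' i y) (e' j y) = (if i = j then 1 else 0)"
    if y: "y \<in> W'" and ij: "i \<in> insert a A" "j \<in> insert a A" for y i j
  proof -
    have yS: "y \<in> S" "y \<in> W" using y W' W by auto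
    have "N y powr (- 1 / 2) * (N y powr (- 1 / 2) * N y) = N y powr (- 1 / 2 + - 1 / 2) * N y"
      by (simp only: powr_add mult.assoc)
    also have "\<dots> = 1" using W'(3)[OF y] by (simp add: powr_minus)
    finally have "N y powr (- 1 / 2) * (N y powr (- 1 / 2) * N y) = 1" .
    then show ?thesis
      using ij orth[OF yS(2)] sym[OF yS(1), of "e i y" "w y"] on[OF yS(2), of i j] insert(2) yS
      by (auto simp: e'_def G_simps N_def[symmetric])
  qed
  ultimately show ?case
    using W' W \<open>x \<in> W'\<close> by (intro exI[of _ W'] exI[of _ e']) auto
qed

text \<open>Gram-Schmidt run through all of \<open>Basis\<close> supplies a witness for the choice
  in \<open>frame\<close>; intersecting with \<open>S\<close> keeps the neighbourhood inside the
  domain.\<close>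

lemma frame_near:
  assumes "x \<in> S"
  obtains W where "open W" "x \<in> W" "W \<subseteq> S" "orthonormal_frame_on G W (frame G x)"
proof -
  have "\<exists>e. orthonormal_frame_near G x e"
    using partial_frame[OF assms finite_Basis order_refl] unfolding orthonormal_frame_near_def
    by blast
  then have "orthonormal_frame_near G x (frame G x)" unfolding frame_def by (rule someI_ex)
  then obtain W where "open W" "x \<in> W" "orthonormal_frame_on G W (frame G x)"
    unfolding orthonormal_frame_near_def orthonormal_frame_on_def[symmetric] by blast
  then show thesis
    using open_S assms
    by (intro that[of "W \<inter> S"]) (auto simp: orthonormal_frame_on_def intro: smooth_on_subset)
qed

text \<open>The map \<open>L\<close> sending the standard basis to the \<open>e j\<close> is
  injective by orthonormality, hence surjective; pairing with \<open>e j\<close> reads off the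
  coefficients.\<close>

lemma orthonormal_expansion:
  fixes e :: "'e \<Rightarrow> 'e"
  assumes y: "y \<in> S" and on: "\<And>i j. i \<in> Basis \<Longrightarrow> j \<in> Basis \<Longrightarrow> G y (e i) (e j) = (if i = j then 1 else 0)"
  shows "w = (\<Sum>j\<in>Basis. G y w (e j) *\<^sub>R e j)"
proof -
  define L where "L z = (\<Sum>j\<in>Basis. (z \<bullet> j) *\<^sub>R e j)" for z
  have L: "G y (L z) (e i) = z \<bullet> i" if "i \<in> Basis" for z i
    using that y by (simp add: L_def G_simps on if_distrib[where f = "\<lambda>t. _ * t"] cong: if_cong)
  have "linear L"
    unfolding L_def
    by (intro linearI) (simp_all add: inner_add_left sum.distrib scaleR_add_left scaleR_sum_right)
  moreover have "inj L"
  proof (subst linear_injective_0[OF \<open>linear L\<close>], intro allI impI)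
    fix z assume "L z = 0"
    have "z \<bullet> i = 0" if "i \<in> Basis" for i
      using L[OF that, of z] y by (simp add: \<open>L z = 0\<close> G_simps)
    then show "z = 0" using euclidean_eqI[of z 0] by simp
  qed
  ultimately have "surj L" using linear_injective_imp_surjective by blast
  then obtain z where z: "w = L z" by (rule surjE)
  have "w = (\<Sum>j\<in>Basis. (z \<bullet> j) *\<^sub>R e j)" unfolding z L_def ..
  also have "\<dots> = (\<Sum>j\<in>Basis. G y w (e j) *\<^sub>R e j)" unfolding z by (simp add: L)
  finally show ?thesis .
qed

end

text \<open>Allows smoothness on \<open>S\<close> to be checked near each point, where an
  orthonormal frame is available.\<close>

lemma cont_diff_on_local:
  "(\<And>x. x \<in> S \<Longrightarrow> \<exists>W. open W \<and> x \<in> W \<and> cont_diff_on n W f) \<Longrightarrow> cont_diff_on n S f"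
proof (induction n arbitrary: f)
  case 0
  have "isCont f x" if "x \<in> S" for x
    using 0[OF that] continuous_on_eq_continuous_at by auto
  then show ?case by (simp add: continuous_at_imp_continuous_on)
next
  case (Suc n)
  then show ?case by simp metis
qed

context riemannian_domain
begin

text \<open>In a smooth local orthonormal frame \<open>w\<close> is the sum of
  \<open>G y (w y) (e j y) *\<^sub>R e j y\<close>, and these coefficients are combinations of the
  given pairings with constant vectors. This replaces inverting the matrix of the metric.\<close>

lemma smooth_on_dual:
  assumes w: "\<And>z. smooth_on S (\<lambda>x. G x (w x) z)"
  shows "smooth_on S w"
  unfolding smooth_on_def
proof (intro allI cont_diff_on_local)
  fix n x assume "x \<in> S"
  then obtain W where W: "open W" "x \<in> W" "W \<subseteq> S" and fr: "orthonormal_frame_on G W (frame G x)"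
    using frame_near by metis
  have e: "\<And>j. j \<in> Basis \<Longrightarrow> smooth_on W (frame G x j)"
    and on: "\<And>y i j. y \<in> W \<Longrightarrow> i \<in> Basis \<Longrightarrow> j \<in> Basis \<Longrightarrow>
       G y (frame G x i y) (frame G x j y) = (if i = j then 1 else 0)"
    using fr by (simp_all add: orthonormal_frame_on_def)
  have c: "smooth_on W (\<lambda>y. G y (w y) (frame G x j y))" if "j \<in> Basis" for j
  proof (rule smooth_on_cong[OF W(1)])
    show "smooth_on W (\<lambda>y. \<Sum>b\<in>Basis. (frame G x j y \<bullet> b) *\<^sub>R G y (w y) b)"
      using W e that
      by (intro smooth_on_sum smooth_on_scaleR smooth_on_inner_left) (auto intro: smooth_on_subset[OF w])
    show "(\<Sum>b\<in>Basis. (frame G x j y \<bullet> b) *\<^sub>R G y (w y) b) = G y (w y) (frame G x j y)"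
      if "y \<in> W" for y
      using that W by (intro linear_sum_Basis[symmetric] linear_G) auto
  qed
  have "smooth_on W w"
  proof (rule smooth_on_cong[OF W(1)])
    show "smooth_on W (\<lambda>y. \<Sum>j\<in>Basis. G y (w y) (frame G x j y) *\<^sub>R frame G x j y)"
      using W by (intro smooth_on_sum smooth_on_scaleR c e)
    show "(\<Sum>j\<in>Basis. G y (w y) (frame G x j y) *\<^sub>R frame G x j y) = w y" if "y \<in> W" for y
      using that W by (intro orthonormal_expansion[symmetric] on) auto
  qed
  then show "\<exists>W. open W \<and> x \<in> W \<and> cont_diff_on n W w"
    using W unfolding smooth_on_def by blast
qed

lemma smooth_on_gradient:
  assumes "smooth_on S F"
  shows "smooth_on S (gradient G F)"
proof (rule smooth_on_dual, rule smooth_on_cong[OF open_S])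
  show "smooth_on S (\<lambda>x. fderiv F x z)" for z using smooth_on_fderiv[OF assms] .
qed (simp add: gradient_spec smooth_on_differentiable[OF assms])

lemma smooth_on_christoffel_const: "smooth_on S (\<lambda>x. christoffel G x u v)"
proof (rule smooth_on_dual, rule smooth_on_cong[OF open_S])
  show "smooth_on S (\<lambda>x. inverse 2 * (fderiv (\<lambda>y. G y v z) x u + fderiv (\<lambda>y. G y u z) x v
      - fderiv (\<lambda>y. G y u v) x z))" for z
    by (intro smooth_on_mult smooth_on_const smooth_on_add smooth_on_diff open_S
        smooth_on_fderiv smooth)
  show "inverse 2 * (fderiv (\<lambda>y. G y v z) x u + fderiv (\<lambda>y. G y u z) x v
      - fderiv (\<lambda>y. G y u v) x z) = G x (christoffel G x u v) z" if "x \<in> S" for x z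
    using christoffel_spec[OF that, of u v z] by simp
qed

sublocale christoffel: bilinear_field S "christoffel G"
  using open_S bilinear_christoffel smooth_on_christoffel_const by unfold_locales

lemma smooth_on_cov:
  assumes "open W" "W \<subseteq> S" "smooth_on W X" "smooth_on W Y"
  shows "smooth_on W (cov G X Y)"
  unfolding cov_def
  using assms
  by (intro smooth_on_add smooth_on_fderiv_field christoffel.smooth_on_apply)

lemma gradient_norm_sq_gradient:
  assumes F: "smooth_on S F" and x: "x \<in> S"
  defines "X \<equiv> gradient G F"
  shows "gradient G (\<lambda>y. G y (X y) (X y)) x = 2 *\<^sub>R cov G X X x"
proof (rule gradient_eqI[OF x])
  fix z
  have X: "smooth_on S X" unfolding X_def using smooth_on_gradient[OF F] .
  note D = smooth_on_has_derivative[OF X x]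
  \<comment> \<open>The identity \<open>G y (X y) v = fderiv F y v\<close> with constant
    \<open>v\<close>, differentiated in direction \<open>z\<close>.\<close>
  have first: "fderiv (\<lambda>y. G y (X x) v) x z + G x (fderiv X x z) v = fderiv (\<lambda>y. fderiv F y v) x z" for v z
  proof -
    have "fderiv (\<lambda>y. G y (X y) v) x z = fderiv (\<lambda>y. fderiv F y v) x z"
      by (rule arg_cong2[where f = "\<lambda>D. D", OF fderiv_cong[OF open_S x] refl])
        (simp add: X_def gradient_spec smooth_on_differentiable[OF F])
    moreover have "fderiv (\<lambda>y. G y (X y) v) x z = fderiv (\<lambda>y. G y (X x) v) x z + G x (fderiv X x z) v"
      using fderiv_apply[OF x D has_derivative_const[of v]] x by (simp add: G_simps)
    ultimately show ?thesis by simp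
  qed
  have "fderiv (\<lambda>y. G y (X y) (X y)) x z
      = fderiv (\<lambda>y. G y (X x) (X x)) x z + 2 * G x (fderiv X x z) (X x)"
    using fderiv_apply[OF x D D, of z] sym[OF x, of "X x" "fderiv X x z"] by simp
  \<comment> \<open>\<open>first\<close> trades the derivative of \<open>X\<close> for second
    derivatives of \<open>F\<close>. Once Schwarz has exchanged their directions,
    \<open>first\<close> is used backwards and the Koszul formula at \<open>X x\<close>,
    \<open>X x\<close>, \<open>z\<close> supplies the rest of \<open>cov\<close>.\<close>
  also have "\<dots> = 2 * fderiv (\<lambda>y. fderiv F y (X x)) x z - fderiv (\<lambda>y. G y (X x) (X x)) x z"
    using first[of "X x" z] by simp
  also have "fderiv (\<lambda>y. fderiv F y (X x)) x z = fderiv (\<lambda>y. fderiv F y z) x (X x)"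
    by (rule fderiv_commute[OF open_S F x])
  also have "2 * \<dots> - fderiv (\<lambda>y. G y (X x) (X x)) x z = G x (2 *\<^sub>R cov G X X x) z"
    using first[of z "X x"] christoffel_spec[OF x, of "X x" "X x" z]
    by (simp add: cov_def G_simps x)
  finally show "G x (2 *\<^sub>R cov G X X x) z = fderiv (\<lambda>y. G y (X y) (X y)) x z" by simp
qed

end

section \<open>Totally geodesic maps\<close>

lemma cov_along_cong:
  assumes "open W" "x \<in> W" "\<And>y. y \<in> W \<Longrightarrow> V y = V' y"
  shows "cov_along K \<phi> X V x = cov_along K \<phi> X V' x"
  using fderiv_cong[OF assms] assms(2,3) by (simp add: cov_along_def)

lemma bilinear_field_compose:
  fixes \<phi> :: "'s::real_normed_vector \<Rightarrow> 't::euclidean_space"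
  assumes "bilinear_field T B" "open S" "smooth_on S \<phi>" "\<phi> ` S \<subseteq> T"
  shows "bilinear_field S (\<lambda>x. B (\<phi> x))"
proof -
  interpret bilinear_field T B by fact
  show ?thesis
    using assms by unfold_locales (auto intro!: bil smooth_on_compose[OF _ _ _ smooth])
qed

lemma fderiv_compose:
  assumes "smooth_on S \<phi>" "x \<in> S" "smooth_on T g" "\<phi> x \<in> T"
  shows "fderiv (\<lambda>y. g (\<phi> y)) x h = fderiv g (\<phi> x) (fderiv \<phi> x h)"
  using diff_chain_at[OF smooth_on_has_derivative[OF assms(1,2)] smooth_on_has_derivative[OF assms(3,4)]]
  by (intro fderivI) (simp add: o_def)

lemma has_derivative_dmap:
  fixes \<phi> :: "'e::euclidean_space \<Rightarrow> 'p::euclidean_space"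
  assumes S: "open S" "x \<in> S" and \<phi>: "smooth_on S \<phi>" and Y: "Y differentiable at x"
  shows "(dmap \<phi> Y has_derivative
    (\<lambda>h. fderiv (\<lambda>y. fderiv \<phi> y (Y x)) x h + fderiv \<phi> x (fderiv Y x h))) (at x)"
proof -
  \<comment> \<open>The differential is linear in one vector only; a dummy scalar factor, later set
    to \<open>1\<close>, makes it a field of bilinear maps, so that the product rule
    applies.\<close>
  interpret bilinear_field S "\<lambda>y a (t::real). t *\<^sub>R fderiv \<phi> y a"
  proof
    show "smooth_on S (\<lambda>x. b *\<^sub>R fderiv \<phi> x a)" for a and b :: real
      using S \<phi> by (intro smooth_on_scaleR smooth_on_const smooth_on_fderiv)
    show "bilinear (\<lambda>a (t::real). t *\<^sub>R fderiv \<phi> x a)" if "x \<in> S" for x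
      unfolding bilinear_def using linear_fderiv[OF \<phi> that]
      by (auto intro!: linearI simp: linear_add linear_cmul algebra_simps)
  qed fact
  have "((\<lambda>y. 1 *\<^sub>R fderiv \<phi> y (Y y)) has_derivative
    (\<lambda>h. fderiv (\<lambda>y. 1 *\<^sub>R fderiv \<phi> y (Y x)) x h + 1 *\<^sub>R fderiv \<phi> x (fderiv Y x h) + 0 *\<^sub>R fderiv \<phi> x (Y x)))
    (at x)"
    using Y by (intro has_derivative_apply[OF S(2) _ has_derivative_const])
      (simp add: frechet_derivative_works)
  then show ?thesis by (simp add: dmap_def[abs_def])
qed

lemma smooth_on_dmap:
  "open S \<Longrightarrow> smooth_on S \<phi> \<Longrightarrow> smooth_on S X \<Longrightarrow> smooth_on S (dmap \<phi> X)"
  unfolding dmap_def[abs_def] by (rule smooth_on_fderiv_field)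

section \<open>Curvature as a commutator of derivatives\<close>

context riemannian_domain
begin

text \<open>Constant fields have zero bracket, so the third term of the curvature vanishes.\<close>

lemma curvature_eq:
  assumes x: "x \<in> S"
  shows "curvature G x u v w =
    cov G (\<lambda>_. u) (cov G (\<lambda>_. v) (\<lambda>_. w)) x - cov G (\<lambda>_. v) (cov G (\<lambda>_. u) (\<lambda>_. w)) x"
proof -
  have "christoffel G x 0 w = 0"
    using linear_0[of "\<lambda>u. christoffel G x u w"] bilinear_christoffel[OF x]
    by (simp add: bilinear_def)
  then have "cov G (lie_bracket (\<lambda>_. u) (\<lambda>_. v)) (\<lambda>_. w) x = 0"
    by (simp add: cov_def lie_bracket_def)
  then show ?thesis by (simp add: curvature_def curvature_field_def)
qed

text \<open>The second-order terms of the commutator are symmetric by Schwarz's theorem.\<close>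

lemma cov_along_commute:
  assumes \<phi>: "open D" "smooth_on D \<phi>" "\<phi> ` D \<subseteq> S" and V: "smooth_on D V" and x: "x \<in> D"
  shows "cov_along G \<phi> (\<lambda>_. u) (cov_along G \<phi> (\<lambda>_. v) V) x
      - cov_along G \<phi> (\<lambda>_. v) (cov_along G \<phi> (\<lambda>_. u) V) x
    = curvature G (\<phi> x) (fderiv \<phi> x u) (fderiv \<phi> x v) (V x)"
proof -
  interpret pb: bilinear_field D "\<lambda>x. christoffel G (\<phi> x)"
    using bilinear_field_compose[OF christoffel.bilinear_field_axioms \<phi>] .
  have fx: "\<phi> x \<in> S" using \<phi> x by blast
  have lin: "linear (christoffel G (\<phi> x) a)" for a
    using bilinear_christoffel[OF fx] by (simp add: bilinear_def)
  \<comment> \<open>Exchanging \<open>u\<close> and \<open>v\<close> and subtracting cancels the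
    second derivatives of \<open>V\<close> and \<open>\<phi>\<close>, and also the two mixed terms
    that pair a derivative of \<open>\<phi>\<close> with one of \<open>V\<close>. What remains is
    the coordinate formula for the curvature.\<close>
  have *: "cov_along G \<phi> (\<lambda>_. u) (cov_along G \<phi> (\<lambda>_. v) V) x
      = fderiv (\<lambda>y. fderiv V y v) x u
        + (fderiv (\<lambda>q. christoffel G q (fderiv \<phi> x v) (V x)) (\<phi> x) (fderiv \<phi> x u)
          + christoffel G (\<phi> x) (fderiv (\<lambda>y. fderiv \<phi> y v) x u) (V x)
          + christoffel G (\<phi> x) (fderiv \<phi> x v) (fderiv V x u))
        + (christoffel G (\<phi> x) (fderiv \<phi> x u) (fderiv V x v)
          + christoffel G (\<phi> x) (fderiv \<phi> x u) (christoffel G (\<phi> x) (fderiv \<phi> x v) (V x)))" for u v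
  proof -
    have "((\<lambda>y. fderiv V y v + christoffel G (\<phi> y) (fderiv \<phi> y v) (V y)) has_derivative
      (\<lambda>h. fderiv (\<lambda>y. fderiv V y v) x h
        + (fderiv (\<lambda>y. christoffel G (\<phi> y) (fderiv \<phi> x v) (V x)) x h
          + christoffel G (\<phi> x) (fderiv (\<lambda>y. fderiv \<phi> y v) x h) (V x)
          + christoffel G (\<phi> x) (fderiv \<phi> x v) (fderiv V x h)))) (at x)"
      by (intro has_derivative_add pb.has_derivative_apply[OF x] smooth_on_has_derivative[OF _ x]
          smooth_on_fderiv V \<phi>)
    from fderivI[OF this] show ?thesis
      by (simp add: cov_along_def[abs_def] linear_add[OF lin]
          fderiv_compose[OF \<phi>(2) x smooth_on_christoffel_const fx])
  qed
  have R: "cov G (\<lambda>_. a) (cov G (\<lambda>_. b) (\<lambda>_. c)) (\<phi> x)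
      = fderiv (\<lambda>q. christoffel G q b c) (\<phi> x) a + christoffel G (\<phi> x) a (christoffel G (\<phi> x) b c)"
    for a b c
    by (simp add: cov_def[abs_def])
  show ?thesis
    unfolding * curvature_eq[OF fx] R
      fderiv_commute[OF \<phi>(1) V x, of v u] fderiv_commute[OF \<phi>(1,2) x, of v u]
    by simp
qed

end

text \<open>\<open>geodesic\<close> says that the second fundamental form vanishes, evaluated on
  constant coordinate fields.\<close>

locale totally_geodesic_map =
  dom: riemannian_domain S G + cod: riemannian_domain T K
  for S :: "'e::euclidean_space set" and G and T :: "'p::euclidean_space set" and K +
  fixes \<phi> :: "'e \<Rightarrow> 'p"
  assumes smooth_map: "smooth_on S \<phi>" and into: "\<phi> ` S \<subseteq> T"
    and geodesic: "x \<in> S \<Longrightarrow> fderiv (\<lambda>y. fderiv \<phi> y v) x u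
      + christoffel K (\<phi> x) (fderiv \<phi> x u) (fderiv \<phi> x v) = fderiv \<phi> x (christoffel G x u v)"
begin

lemma linear_d: "x \<in> S \<Longrightarrow> linear (fderiv \<phi> x)"
  using linear_fderiv[OF smooth_map] .

text \<open>For constant \<open>Y\<close> this is \<open>geodesic\<close>. For general
  \<open>Y\<close> the product rule adds \<open>fderiv \<phi> x (fderiv Y x (X x))\<close>, the
  image of the derivative part of \<open>cov\<close>.\<close>

lemma cov_along_dmap:
  assumes x: "x \<in> S" and Y: "Y differentiable at x"
  shows "cov_along K \<phi> X (dmap \<phi> Y) x = dmap \<phi> (cov G X Y) x"
  using geodesic[OF x, of "Y x" "X x"]
  by (simp add: cov_along_def fderivI[OF has_derivative_dmap[OF dom.open_S x smooth_map Y]])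
    (simp add: dmap_def cov_def linear_add[OF linear_d[OF x]])

lemma curvature_dmap:
  assumes x: "x \<in> S"
  shows "curvature K (\<phi> x) (fderiv \<phi> x u) (fderiv \<phi> x v) (fderiv \<phi> x w)
    = fderiv \<phi> x (curvature G x u v w)"
proof -
  have V: "smooth_on S (dmap \<phi> (\<lambda>_. w))"
    by (intro smooth_on_dmap dom.open_S smooth_map smooth_on_const)
  have *: "cov_along K \<phi> (\<lambda>_. u) (cov_along K \<phi> (\<lambda>_. v) (dmap \<phi> (\<lambda>_. w))) x
      = fderiv \<phi> x (cov G (\<lambda>_. u) (cov G (\<lambda>_. v) (\<lambda>_. w)) x)" for u v
  proof -
    have "cov_along K \<phi> (\<lambda>_. u) (cov_along K \<phi> (\<lambda>_. v) (dmap \<phi> (\<lambda>_. w))) x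
        = cov_along K \<phi> (\<lambda>_. u) (dmap \<phi> (cov G (\<lambda>_. v) (\<lambda>_. w))) x"
      by (rule cov_along_cong[OF dom.open_S x]) (simp add: cov_along_dmap)
    also have "\<dots> = dmap \<phi> (cov G (\<lambda>_. u) (cov G (\<lambda>_. v) (\<lambda>_. w))) x"
      by (intro cov_along_dmap x smooth_on_differentiable[OF _ x] dom.smooth_on_cov dom.open_S
          order_refl smooth_on_const)
    finally show ?thesis by (simp add: dmap_def)
  qed
  have "curvature K (\<phi> x) (fderiv \<phi> x u) (fderiv \<phi> x v) (dmap \<phi> (\<lambda>_. w) x)
      = fderiv \<phi> x (curvature G x u v w)"
    unfolding cod.cov_along_commute[OF dom.open_S smooth_map into V x, symmetric] *
      dom.curvature_eq[OF x] linear_diff[OF linear_d[OF x]] ..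
  then show ?thesis by (simp add: dmap_def)
qed

text \<open>Each frame vector contributes zero by \<open>cov_along_dmap\<close>, which requires the
  chosen frame to be differentiable at \<open>x\<close>.\<close>

lemma tension_eq_0:
  assumes x: "x \<in> S"
  shows "tension G K \<phi> x = 0"
proof -
  obtain W where W: "open W" "x \<in> W" "orthonormal_frame_on G W (frame G x)"
    using dom.frame_near[OF x] by metis
  then have "frame G x j differentiable at x" if "j \<in> Basis" for j
    using that smooth_on_differentiable by (auto simp: orthonormal_frame_on_def)
  then show ?thesis
    by (simp add: tension_def Let_def cov_along_dmap[OF x])
qed

lemma f_tension_eq: "x \<in> S \<Longrightarrow> f_tension G K f \<phi> x = dmap \<phi> (gradient G f) x"
  by (simp add: f_tension_def tension_eq_0)

text \<open>\<open>V\<close> is prescribed on \<open>S\<close> alone because the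
  \<open>f\<close>-tension field is known to be \<open>dmap \<phi> X\<close> only there; openness of
  \<open>S\<close> makes this enough for two derivatives.\<close>

lemma trace_cov2_along_eq:
  assumes x: "x \<in> S" and X: "smooth_on S X" and V: "\<And>y. y \<in> S \<Longrightarrow> V y = dmap \<phi> X y"
  shows "trace_cov2_along G K \<phi> V x = fderiv \<phi> x (trace_cov2 G X x)"
proof -
  obtain W where W: "open W" "x \<in> W" "W \<subseteq> S" and fr: "orthonormal_frame_on G W (frame G x)"
    using dom.frame_near[OF x] by metis
  have cov_V: "cov_along K \<phi> E V y = dmap \<phi> (cov G E X) y" if "y \<in> S" for E y
    using cov_along_cong[OF dom.open_S that V] cov_along_dmap[OF that smooth_on_differentiable[OF X that]]
    by simp
  have "cov_along K \<phi> (frame G x j) (cov_along K \<phi> (frame G x j) V) x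
      - cov_along K \<phi> (cov G (frame G x j) (frame G x j)) V x
    = fderiv \<phi> x (cov G (frame G x j) (cov G (frame G x j) X) x
      - cov G (cov G (frame G x j) (frame G x j)) X x)" if "j \<in> Basis" for j
  proof -
    have e: "smooth_on W (frame G x j)" using fr that by (simp add: orthonormal_frame_on_def)
    have "cov_along K \<phi> (frame G x j) (cov_along K \<phi> (frame G x j) V) x
        = cov_along K \<phi> (frame G x j) (dmap \<phi> (cov G (frame G x j) X)) x"
      by (rule cov_along_cong[OF dom.open_S x]) (rule cov_V)
    also have "\<dots> = dmap \<phi> (cov G (frame G x j) (cov G (frame G x j) X)) x"
      by (intro cov_along_dmap x smooth_on_differentiable[OF _ W(2)] dom.smooth_on_cov W e
          smooth_on_subset[OF X])
    finally show ?thesis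
      by (simp add: cov_V[OF x]) (simp add: dmap_def linear_diff[OF linear_d[OF x]])
  qed
  then show ?thesis
    by (simp add: trace_cov2_along_def trace_cov2_def Let_def linear_sum[OF linear_d[OF x]])
qed

lemma trace_curvature_along_eq:
  assumes x: "x \<in> S" and V: "V x = dmap \<phi> X x"
  shows "trace_curvature_along G K \<phi> V x = fderiv \<phi> x (ricci G X x)"
  using curvature_dmap[OF x]
  by (simp add: trace_curvature_along_def ricci_def Let_def V linear_sum[OF linear_d[OF x]])
    (simp add: dmap_def)

text \<open>The three terms are the images of \<open>- f x\<close> times the trace,
  \<open>- f x\<close> times the Ricci term, and minus \<open>cov G X X x\<close>. The last is half
  of a gradient, whence the factor \<open>- (1 / 2)\<close>.\<close>

lemma bi_f_tension_eq:
  assumes x: "x \<in> S" and f: "smooth_on S f"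
  defines "X \<equiv> gradient G f"
  shows "bi_f_tension G K f \<phi> x = - (1 / 2) *\<^sub>R fderiv \<phi> x
    ((2 * f x) *\<^sub>R (trace_cov2 G X x + ricci G X x) + gradient G (\<lambda>y. G y (X y) (X y)) x)"
proof -
  have X: "smooth_on S X" unfolding X_def using dom.smooth_on_gradient[OF f] .
  have V: "f_tension G K f \<phi> y = dmap \<phi> X y" if "y \<in> S" for y
    unfolding X_def using f_tension_eq[OF that] .
  have "cov_along K \<phi> X (f_tension G K f \<phi>) x = fderiv \<phi> x (cov G X X x)"
  proof -
    have "cov_along K \<phi> X (f_tension G K f \<phi>) x = cov_along K \<phi> X (dmap \<phi> X) x"
      by (rule cov_along_cong[OF dom.open_S x V])
    then show ?thesis
      unfolding cov_along_dmap[OF x smooth_on_differentiable[OF X x]] by (simp only: dmap_def)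
  qed
  moreover have "gradient G (\<lambda>y. G y (X y) (X y)) x = 2 *\<^sub>R cov G X X x"
    unfolding X_def by (rule dom.gradient_norm_sq_gradient[OF f x])
  ultimately show ?thesis
    using linear_d[OF x]
    by (simp add: bi_f_tension_def X_def[symmetric] trace_cov2_along_eq[OF x X V]
        trace_curvature_along_eq[where X = X and V = "f_tension G K f \<phi>", OF x V[OF x]]
        linear_add linear_cmul algebra_simps)
qed

end

section \<open>Isometries and slices of warped products\<close>

text \<open>Source and target share the model space, so the differential, injective by definiteness,
  is bijective.\<close>

locale local_isometry =
  dom: riemannian_domain S G + cod: riemannian_domain T K
  for S :: "'e::euclidean_space set" and G and T :: "'e set" and K +
  fixes \<theta> :: "'e \<Rightarrow> 'e"
  assumes smooth_iso: "smooth_on S \<theta>" and iso_into: "\<theta> ` S \<subseteq> T"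
    and isometry: "x \<in> S \<Longrightarrow> G x u v = K (\<theta> x) (fderiv \<theta> x u) (fderiv \<theta> x v)"
begin

lemma fderiv_eq_0D:
  assumes "x \<in> S" "fderiv \<theta> x u = 0"
  shows "u = 0"
proof (rule ccontr)
  assume "u \<noteq> 0"
  then show False
    using dom.pos[OF assms(1), of u] cod.G_simps(7)[of "\<theta> x"] iso_into assms
    by (auto simp: isometry image_subset_iff)
qed

lemma surj_fderiv: "x \<in> S \<Longrightarrow> surj (fderiv \<theta> x)"
  using linear_injective_imp_surjective[OF linear_fderiv[OF smooth_iso]]
    linear_injective_0[OF linear_fderiv[OF smooth_iso]] fderiv_eq_0D by blast

text \<open>The transformation law of Christoffel symbols. It is tested against vectors
  \<open>d z\<close>, which exhaust the model space, by comparing the Koszul formulas of both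
  metrics.\<close>

lemma geodesic_isometry:
  assumes x: "x \<in> S"
  shows "fderiv (\<lambda>y. fderiv \<theta> y v) x u + christoffel K (\<theta> x) (fderiv \<theta> x u) (fderiv \<theta> x v)
    = fderiv \<theta> x (christoffel G x u v)"
proof (rule cod.nondegenerate)
  show tx: "\<theta> x \<in> T" using x iso_into by blast
  interpret pb: bilinear_field S "\<lambda>x. K (\<theta> x)"
    using bilinear_field_compose[OF cod.bilinear_field_axioms dom.open_S smooth_iso iso_into] .
  define D where "D a b = fderiv (\<lambda>y. fderiv \<theta> y a) x b" for a b
  have D_sym: "D a b = D b a" for a b
    unfolding D_def by (rule fderiv_commute[OF dom.open_S smooth_iso x])
  define d where "d = fderiv \<theta> x"
  \<comment> \<open>The derivative of \<open>K\<close> alone, with its two arguments frozen at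
    \<open>x\<close>.\<close>
  define C where "C a b h = fderiv (\<lambda>q. K q (d a) (d b)) (\<theta> x) (d h)" for a b h
  have DG: "fderiv (\<lambda>y. G y a b) x h = C a b h + K (\<theta> x) (D a h) (d b) + K (\<theta> x) (d a) (D b h)"
    for a b h
  proof -
    have "fderiv (\<lambda>y. G y a b) x h = fderiv (\<lambda>y. K (\<theta> y) (fderiv \<theta> y a) (fderiv \<theta> y b)) x h"
      by (rule arg_cong2[where f = "\<lambda>D. D", OF fderiv_cong[OF dom.open_S x] refl]) (rule isometry)
    also have "\<dots> = fderiv (\<lambda>y. K (\<theta> y) (d a) (d b)) x h + K (\<theta> x) (D a h) (d b) + K (\<theta> x) (d a) (D b h)"
      unfolding d_def D_def
      by (rule pb.fderiv_apply[OF x]; intro smooth_on_has_derivative[OF _ x] smooth_on_fderiv smooth_iso)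
    finally show ?thesis
      unfolding C_def d_def using fderiv_compose[OF smooth_iso x cod.smooth tx] by metis
  qed
  fix w
  obtain z where z: "w = d z" using surj_fderiv[OF x] unfolding d_def by (metis surjD)
  have "2 * K (\<theta> x) (D v u + christoffel K (\<theta> x) (d u) (d v)) w
      = 2 * K (\<theta> x) (D v u) (d z) + (C v z u + C u z v - C u v z)"
    unfolding z C_def using cod.christoffel_spec[OF tx, of "d u" "d v" "d z"]
    by (simp add: cod.G_simps tx)
  \<comment> \<open>Of the six terms with second derivatives of \<open>\<theta>\<close>, four cancel
    by symmetry of \<open>D\<close> and \<open>K\<close>; the other two add up to
    \<open>2 * K (\<theta> x) (D v u) (d z)\<close>.\<close>
  also have "\<dots> = 2 * G x (christoffel G x u v) z"
    unfolding dom.christoffel_spec[OF x] DG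
    using D_sym[of u v] D_sym[of z u] D_sym[of z v] cod.sym[OF tx, of "D v z"]
      cod.sym[OF tx, of "D u z"] by simp
  also have "\<dots> = 2 * K (\<theta> x) (d (christoffel G x u v)) w"
    unfolding z d_def isometry[OF x] ..
  finally show "K (\<theta> x) (fderiv (\<lambda>y. fderiv \<theta> y v) x u
      + christoffel K (\<theta> x) (fderiv \<theta> x u) (fderiv \<theta> x v)) w
    = K (\<theta> x) (fderiv \<theta> x (christoffel G x u v)) w"
    by (simp add: D_def d_def)
qed

end

text \<open>The metric of \<open>warped_chart\<close> in pure coordinate form, with the warping
  function already read in the base chart.\<close>

definition warped_metric ::
  "('e \<Rightarrow> real) \<Rightarrow> 'e::euclidean_space metric_field \<Rightarrow> 'n::euclidean_space metric_field \<Rightarrow>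
    ('e \<times> 'n) metric_field" where
  "warped_metric l G H = (\<lambda>(x, y) (u, v) (u', v'). G x u u' + (l x)\<^sup>2 * H y v v')"

lemma warped_metric_apply:
  "warped_metric l G H p a b = G (fst p) (fst a) (fst b) + (l (fst p))\<^sup>2 * H (snd p) (snd a) (snd b)"
  by (simp add: warped_metric_def case_prod_beta)

locale warped_domain =
  base: riemannian_domain S G + fib: riemannian_domain T H
  for S :: "'e::euclidean_space set" and G and T :: "'n::euclidean_space set" and H +
  fixes l :: "'e \<Rightarrow> real"
  assumes smooth_warp: "smooth_on S l" and warp_pos: "x \<in> S \<Longrightarrow> l x > 0"
begin

lemma open_Times: "open (S \<times> T)"
  by (rule open_Times[OF base.open_S fib.open_S])

sublocale riemannian_domain "S \<times> T" "warped_metric l G H"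
proof
  show "riemannian_metric_on (S \<times> T) (warped_metric l G H)"
    unfolding riemannian_metric_on_def
  proof (intro conjI ballI allI impI)
    fix p :: "'e \<times> 'n" assume "p \<in> S \<times> T"
    then have p: "fst p \<in> S" "snd p \<in> T" by auto
    show "bilinear (warped_metric l G H p)"
      unfolding bilinear_def warped_metric_apply
      by (auto intro!: linearI simp: base.G_simps fib.G_simps p algebra_simps)
    show "warped_metric l G H p u v = warped_metric l G H p v u" for u v
      by (simp add: warped_metric_apply base.sym[OF p(1), of "fst u"] fib.sym[OF p(2), of "snd u"])
    show "0 < warped_metric l G H p u u" if "u \<noteq> 0" for u
    proof -
      have G: "G (fst p) (fst u) (fst u) \<ge> 0" "fst u \<noteq> 0 \<Longrightarrow> G (fst p) (fst u) (fst u) > 0"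
        using base.pos[OF p(1), of "fst u"] p by (cases "fst u = 0"; force simp: base.G_simps)+
      have H: "H (snd p) (snd u) (snd u) \<ge> 0" "snd u \<noteq> 0 \<Longrightarrow> H (snd p) (snd u) (snd u) > 0"
        using fib.pos[OF p(2), of "snd u"] p by (cases "snd u = 0"; force simp: fib.G_simps)+
      have "(l (fst p))\<^sup>2 > 0" using warp_pos[OF p(1)] by simp
      then show ?thesis
        using G H that unfolding warped_metric_apply
        by (cases "fst u = 0") (auto simp: prod_eq_iff intro: add_nonneg_pos add_pos_nonneg)
    qed
  next
    have fst: "fst ` (S \<times> T) \<subseteq> S" "smooth_on (S \<times> T) fst"
      by (auto intro: smooth_on_linear open_Times bounded_linear_fst)
    have snd: "snd ` (S \<times> T) \<subseteq> T" "smooth_on (S \<times> T) snd"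
      by (auto intro: smooth_on_linear open_Times bounded_linear_snd)
    have "smooth_on (S \<times> T) (\<lambda>p. G (fst p) a b)" "smooth_on (S \<times> T) (\<lambda>p. l (fst p))"
      "smooth_on (S \<times> T) (\<lambda>p. H (snd p) c d)" for a b c d
      using smooth_on_compose[OF open_Times fst base.smooth]
        smooth_on_compose[OF open_Times fst smooth_warp]
        smooth_on_compose[OF open_Times snd fib.smooth] .
    then show "smooth_on (S \<times> T) (\<lambda>p. warped_metric l G H p u v)" for u v
      unfolding warped_metric_apply power2_eq_square
      by (intro smooth_on_add smooth_on_mult open_Times)
  qed
qed (rule open_Times)

text \<open>Every metric coefficient in the Koszul formula has a horizontal argument, so the fibre
  term is identically zero and the warping function is never differentiated.\<close>

lemma christoffel_horizontal:
  assumes x: "x \<in> S" and y: "y \<in> T"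
  shows "christoffel (warped_metric l G H) (x, y) (u, 0) (v, 0) = (christoffel G x u v, 0)"
proof (rule christoffel_eqI)
  have D: "fderiv (\<lambda>p. warped_metric l G H p (a, 0) z) (x, y) h
      = fderiv (\<lambda>x. G x a (fst z)) x (fst h)" for a z h
  proof -
    have "fderiv (\<lambda>p. warped_metric l G H p (a, 0) z) (x, y) h
        = fderiv (\<lambda>p. G (fst p) a (fst z)) (x, y) h"
      by (rule arg_cong2[where f = "\<lambda>D. D", OF fderiv_cong[OF open_Times] refl])
        (auto simp: x y warped_metric_apply fib.G_simps)
    also have "\<dots> = fderiv (\<lambda>x. G x a (fst z)) x (fst h)"
      using smooth_on_has_derivative[OF base.smooth x, of a "fst z"]
      by (intro fderivI has_derivative_compose[OF has_derivative_fst[OF has_derivative_ident]]) simp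
    finally show ?thesis .
  qed
  show "2 * warped_metric l G H (x, y) (christoffel G x u v, 0) z
      = fderiv (\<lambda>p. warped_metric l G H p (v, 0) z) (x, y) (u, 0)
        + fderiv (\<lambda>p. warped_metric l G H p (u, 0) z) (x, y) (v, 0)
        - fderiv (\<lambda>p. warped_metric l G H p (u, 0) (v, 0)) (x, y) z" for z
    using base.christoffel_spec[OF x, of u v "fst z"]
    by (simp add: D) (simp add: warped_metric_apply fib.G_simps y)
qed (use x y in simp)

end

lemma (in local_isometry) fderiv_slice:
  "x \<in> S \<Longrightarrow> fderiv (\<lambda>x. (\<theta> x, b)) x u = (fderiv \<theta> x u, 0)"
  by (intro fderivI has_derivative_Pair smooth_on_has_derivative[OF smooth_iso] has_derivative_const)

lemma (in local_isometry) fderiv_slice_eq_0_iff: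
  assumes "x \<in> S"
  shows "fderiv (\<lambda>x. (\<theta> x, b)) x u = 0 \<longleftrightarrow> u = 0"
  using fderiv_eq_0D[OF assms, of u] linear_0[OF linear_fderiv[OF smooth_iso assms]]
  by (auto simp: fderiv_slice[OF assms] zero_prod_def)

text \<open>The constant second component contributes no derivatives, and the first component
  reduces to \<open>geodesic_isometry\<close>.\<close>

lemma totally_geodesic_slice:
  assumes "local_isometry U G' S G \<theta>" and "warped_domain S G T H l" and b: "b \<in> T"
  shows "totally_geodesic_map U G' (S \<times> T) (warped_metric l G H) (\<lambda>x. (\<theta> x, b))"
proof -
  interpret iso: local_isometry U G' S G \<theta> by fact
  interpret w: warped_domain S G T H l by fact
  show ?thesis
  proof
    show "smooth_on U (\<lambda>x. (\<theta> x, b))"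
      by (intro smooth_on_Pair iso.dom.open_S iso.smooth_iso smooth_on_const)
    show "(\<lambda>x. (\<theta> x, b)) ` U \<subseteq> S \<times> T" using b iso.iso_into by auto
    fix x u v assume x: "x \<in> U"
    then have "\<theta> x \<in> S" using iso.iso_into by blast
    have "fderiv (\<lambda>y. fderiv (\<lambda>x. (\<theta> x, b)) y v) x u = fderiv (\<lambda>y. (fderiv \<theta> y v, 0 :: 'b)) x u"
      by (rule arg_cong2[where f = "\<lambda>D. D", OF fderiv_cong[OF iso.dom.open_S x] refl])
        (rule iso.fderiv_slice)
    also have "\<dots> = (fderiv (\<lambda>y. fderiv \<theta> y v) x u, 0)"
      by (intro fderivI has_derivative_Pair has_derivative_const smooth_on_has_derivative[OF _ x]
          smooth_on_fderiv iso.smooth_iso)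
    finally show "fderiv (\<lambda>y. fderiv (\<lambda>x. (\<theta> x, b)) y v) x u
        + christoffel (warped_metric l G H) (\<theta> x, b) (fderiv (\<lambda>x. (\<theta> x, b)) x u)
          (fderiv (\<lambda>x. (\<theta> x, b)) x v)
      = fderiv (\<lambda>x. (\<theta> x, b)) x (christoffel G' x u v)"
      using iso.geodesic_isometry[OF x, of v u] \<open>\<theta> x \<in> S\<close> b
      by (simp add: iso.fderiv_slice[OF x] w.christoffel_horizontal)
  qed
qed

section \<open>Charts of the warped product\<close>

lemma riemannian_domain_subset:
  "riemannian_domain S G \<Longrightarrow> open W \<Longrightarrow> W \<subseteq> S \<Longrightarrow> riemannian_domain W G"
  unfolding riemannian_domain_def riemannian_metric_on_def by (blast intro: smooth_on_subset)

locale manifold =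
  fixes M :: "('a, 'e::euclidean_space) riem"
  assumes riem: "riemannian_manifold M"
begin

lemma chart: "c \<in> atlas M \<Longrightarrow> riemannian_chart (mtop M) c"
  using riem by (simp add: riemannian_manifold_def)

lemma chart_domain: "c \<in> atlas M \<Longrightarrow> riemannian_domain (chart_image c) (chart_metric c)"
  using chart[of c] by (simp add: riemannian_chart_def riemannian_domain_def)

lemma openin_dom: "c \<in> atlas M \<Longrightarrow> openin (mtop M) (chart_dom c)"
  using chart by (simp add: riemannian_chart_def)

lemma topspace_dom: "c \<in> atlas M \<Longrightarrow> topspace (subtopology (mtop M) (chart_dom c)) = chart_dom c"
  using openin_subset[OF openin_dom] by auto

lemma homeo: "c \<in> atlas M \<Longrightarrow>
    homeomorphic_map (subtopology (mtop M) (chart_dom c)) (top_of_set (chart_image c)) (chart_map c)"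
  using chart by (simp add: riemannian_chart_def)

lemma inj_chart: "c \<in> atlas M \<Longrightarrow> inj_on (chart_map c) (chart_dom c)"
  using homeomorphic_imp_injective_map[OF homeo] topspace_dom by metis

lemma chart_inv [simp]:
  "c \<in> atlas M \<Longrightarrow> p \<in> chart_dom c \<Longrightarrow> chart_inv c (chart_map c p) = p"
  using inj_chart by (simp add: inv_into_f_f)

lemma open_overlap:
  assumes "c \<in> atlas M" "c' \<in> atlas M"
  shows "open (chart_map c ` (chart_dom c \<inter> chart_dom c'))"
proof -
  have "openin (subtopology (mtop M) (chart_dom c)) (chart_dom c \<inter> chart_dom c')"
    using openin_dom[OF assms(2)] by (auto simp: openin_subtopology)
  moreover have "chart_dom c \<inter> chart_dom c' \<subseteq> topspace (subtopology (mtop M) (chart_dom c))"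
    using topspace_dom[OF assms(1)] by blast
  ultimately have "openin (top_of_set (chart_image c)) (chart_map c ` (chart_dom c \<inter> chart_dom c'))"
    using homeomorphic_map_openness[OF homeo[OF assms(1)]] by blast
  then show ?thesis
    using openin_open_trans chart[OF assms(1)] by (auto simp: riemannian_chart_def)
qed

lemma transition_isometry:
  assumes c: "c \<in> atlas M" "c' \<in> atlas M"
  shows "local_isometry (chart_map c ` (chart_dom c \<inter> chart_dom c')) (chart_metric c)
    (chart_image c') (chart_metric c') (chart_map c' \<circ> chart_inv c)"
proof -
  let ?U = "chart_map c ` (chart_dom c \<inter> chart_dom c')"
  interpret riemannian_domain ?U "chart_metric c"
    by (rule riemannian_domain_subset[OF chart_domain[OF c(1)] open_overlap[OF c]]) auto
  interpret cod: riemannian_domain "chart_image c'" "chart_metric c'"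
    by (rule chart_domain[OF c(2)])
  have "compatible_charts c c'" using riem c by (simp add: riemannian_manifold_def)
  then show ?thesis
    using c by unfold_locales (auto simp: compatible_charts_def Let_def)
qed

text \<open>Vanishing derivatives in charts make \<open>f\<close> locally constant, and level sets
  of a locally constant function are open and closed.\<close>

lemma constant_if_fderiv_0:
  assumes conn: "connected_space (mtop M)" and f: "smooth_function M f"
    and D: "\<And>c x v. c \<in> atlas M \<Longrightarrow> x \<in> chart_image c \<Longrightarrow> fderiv (f \<circ> chart_inv c) x v = 0"
  shows "f constant_on topspace (mtop M)"
proof -
  have local: "\<exists>W. openin (mtop M) W \<and> p \<in> W \<and> (\<forall>q\<in>W. f q = f p)" if p: "p \<in> topspace (mtop M)" for p
  proof -
    obtain c where c: "c \<in> atlas M" "p \<in> chart_dom c"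
      using p riem unfolding riemannian_manifold_def by blast
    have "open (chart_image c)" using chart[OF c(1)] by (simp add: riemannian_chart_def)
    \<comment> \<open>A ball is convex, so a vanishing derivative forces constancy on it.\<close>
    then obtain r where r: "r > 0" "ball (chart_map c p) r \<subseteq> chart_image c"
      using c(2) openE by blast
    have "((f \<circ> chart_inv c) has_derivative (\<lambda>v. 0)) (at x within ball (chart_map c p) r)"
      if "x \<in> ball (chart_map c p) r" for x
    proof -
      have x: "x \<in> chart_image c" using that r by blast
      have "fderiv (f \<circ> chart_inv c) x = (\<lambda>v. 0)" using D[OF c(1) x] by blast
      moreover have "smooth_on (chart_image c) (f \<circ> chart_inv c)"
        using f c(1) by (simp add: smooth_function_def)
      ultimately show ?thesis
        using smooth_on_has_derivative[OF _ x] has_derivative_at_withinI by metis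
    qed
    then obtain k where k: "\<And>x. x \<in> ball (chart_map c p) r \<Longrightarrow> (f \<circ> chart_inv c) x = k"
      using has_derivative_zero_constant[OF convex_ball] by metis
    define W where "W = {q \<in> chart_dom c. chart_map c q \<in> ball (chart_map c p) r}"
    have "continuous_map (subtopology (mtop M) (chart_dom c)) euclidean (chart_map c)"
      using homeomorphic_imp_continuous_map[OF homeo[OF c(1)]] continuous_map_in_subtopology by blast
    from openin_continuous_map_preimage[OF this, of "ball (chart_map c p) r"]
    have "openin (subtopology (mtop M) (chart_dom c)) W"
      unfolding topspace_dom[OF c(1)] W_def by (simp add: open_openin[symmetric])
    then have "openin (mtop M) W" using openin_trans_full openin_dom[OF c(1)] by blast
    moreover have "f q = k" if "q \<in> W" for q
      using k[of "chart_map c q"] that c(1) by (simp add: W_def)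
    moreover have "p \<in> W" using c r by (simp add: W_def)
    ultimately show ?thesis by metis
  qed
  show ?thesis
  proof (cases "topspace (mtop M) = {}")
    case False
    then obtain p0 where p0: "p0 \<in> topspace (mtop M)" by blast
    define A where "A = {p \<in> topspace (mtop M). f p = f p0}"
    \<comment> \<open>For locally constant \<open>f\<close> every condition on the value of
      \<open>f\<close> defines an open set; the level set and its complement are two
      instances.\<close>
    have "openin (mtop M) {p \<in> topspace (mtop M). P (f p)}" for P
    proof (subst openin_subopen, intro ballI)
      fix p assume p: "p \<in> {p \<in> topspace (mtop M). P (f p)}"
      then obtain W where "openin (mtop M) W" "p \<in> W" "\<forall>q\<in>W. f q = f p" using local by blast
      then show "\<exists>T. openin (mtop M) T \<and> p \<in> T \<and> T \<subseteq> {p \<in> topspace (mtop M). P (f p)}"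
        using p openin_subset by (intro exI[of _ W]) fastforce
    qed
    from this[of "\<lambda>t. t = f p0"] this[of "\<lambda>t. t \<noteq> f p0"]
    have "openin (mtop M) A" "closedin (mtop M) A"
      by (auto simp: A_def closedin_def set_diff_eq)
        (smt (verit) Collect_cong)
    then have "A = topspace (mtop M)"
      using conn p0 unfolding connected_space_clopen_in A_def by blast
    then show ?thesis unfolding constant_on_def A_def by blast
  qed (simp add: constant_on_def)
qed

end

section \<open>The inclusion in the charts of the warped product\<close>

lemma chart_metric_warped_chart:
  "chart_metric (warped_chart lam c d)
    = warped_metric (lam \<circ> chart_inv c) (chart_metric c) (chart_metric d)"
  by (simp add: warped_chart_def warped_metric_def)

lemma slice_in_charts:
  "chart_map (warped_chart lam c' d) \<circ> (\<lambda>x. (x, y0)) \<circ> chart_inv c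
    = (\<lambda>x. ((chart_map c' \<circ> chart_inv c) x, chart_map d y0))"
  by (simp add: warped_chart_def fun_eq_iff)

lemma chart_dom_warped_chart [simp]:
  "chart_dom (warped_chart lam c d) = chart_dom c \<times> chart_dom d"
  by (simp add: warped_chart_def)

lemma ball_atlas_warped_product:
  "(\<forall>d\<in>atlas (warped_product M lam N). P d) \<longleftrightarrow>
    (\<forall>c\<in>atlas M. \<forall>d\<in>atlas N. P (warped_chart lam c d))"
  by (auto simp: warped_product_def)

locale warped_product_slice =
  base: manifold M + fiber: manifold N
  for M :: "('a, 'e::euclidean_space) riem" and N :: "('b, 'n::euclidean_space) riem" +
  fixes lam :: "'a \<Rightarrow> real" and y0 :: 'b
  assumes lam: "smooth_function M lam" "p \<in> topspace (mtop M) \<Longrightarrow> lam p > 0"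
    and y0: "y0 \<in> topspace (mtop N)"
begin

lemma slice_totally_geodesic:
  assumes c: "c \<in> atlas M" "c' \<in> atlas M" and d: "d \<in> atlas N" "y0 \<in> chart_dom d"
  shows "totally_geodesic_map (chart_map c ` (chart_dom c \<inter> chart_dom c')) (chart_metric c)
    (chart_image c' \<times> chart_image d) (chart_metric (warped_chart lam c' d))
    (\<lambda>x. ((chart_map c' \<circ> chart_inv c) x, chart_map d y0))"
  unfolding chart_metric_warped_chart
proof (rule totally_geodesic_slice[OF base.transition_isometry[OF c]])
  interpret b: riemannian_domain "chart_image c'" "chart_metric c'" by (rule base.chart_domain[OF c(2)])
  interpret f: riemannian_domain "chart_image d" "chart_metric d" by (rule fiber.chart_domain[OF d(1)])
  show "warped_domain (chart_image c') (chart_metric c') (chart_image d) (chart_metric d)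
      (lam \<circ> chart_inv c')"
  proof
    show "smooth_on (chart_image c') (lam \<circ> chart_inv c')"
      using lam(1) c(2) by (simp add: smooth_function_def)
    show "0 < (lam \<circ> chart_inv c') x" if "x \<in> chart_image c'" for x
      using that c(2) openin_subset[OF base.openin_dom[OF c(2)]] by (auto intro!: lam(2))
  qed
qed (use d in blast)

lemma smooth_map_slice: "smooth_map M (warped_product M lam N) (\<lambda>x. (x, y0))"
  unfolding smooth_map_def ball_atlas_warped_product
proof (intro conjI ballI)
  show "continuous_map (mtop M) (mtop (warped_product M lam N)) (\<lambda>x. (x, y0))"
    using y0 by (simp add: warped_product_def continuous_map_paired)
  fix c c' d assume c: "c \<in> atlas M" "c' \<in> atlas M" and d: "d \<in> atlas N"
  interpret local_isometry "chart_map c ` (chart_dom c \<inter> chart_dom c')" "chart_metric c"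
    "chart_image c'" "chart_metric c'" "chart_map c' \<circ> chart_inv c"
    by (rule base.transition_isometry[OF c])
  have "smooth_on (chart_map c ` (chart_dom c \<inter> chart_dom c'))
      (\<lambda>x. ((chart_map c' \<circ> chart_inv c) x, chart_map d y0))"
    by (intro smooth_on_Pair dom.open_S smooth_iso smooth_on_const)
  then show "smooth_on (chart_map c ` {p \<in> chart_dom c. (p, y0) \<in> chart_dom (warped_chart lam c' d)})
      (chart_map (warped_chart lam c' d) \<circ> (\<lambda>x. (x, y0)) \<circ> chart_inv c)"
    unfolding slice_in_charts by (rule smooth_on_subset) auto
qed

lemma exists_fiber_chart: obtains d where "d \<in> atlas N" "y0 \<in> chart_dom d"
  using y0 fiber.riem unfolding riemannian_manifold_def by blast

text \<open>The \<open>f\<close>-tension is the image of the gradient under an injective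
  differential. Using \<open>c\<close> also as base factor of the target chart reaches every point
  of \<open>chart_image c\<close>.\<close>

lemma f_harmonic_slice_imp_constant:
  assumes conn: "connected_space (mtop M)" and f: "smooth_function M f"
    and harm: "f_harmonic M (warped_product M lam N) f (\<lambda>x. (x, y0))"
  shows "f constant_on topspace (mtop M)"
proof (rule base.constant_if_fderiv_0[OF conn f])
  fix c x v assume c: "c \<in> atlas M" and x: "x \<in> chart_image c"
  then obtain p where p: "p \<in> chart_dom c" "x = chart_map c p" by blast
  obtain d where d: "d \<in> atlas N" "y0 \<in> chart_dom d" by (rule exists_fiber_chart)
  let ?G = "chart_metric c" and ?F = "f \<circ> chart_inv c"
  interpret iso: local_isometry "chart_map c ` (chart_dom c \<inter> chart_dom c)" ?G
    "chart_image c" ?G "chart_map c \<circ> chart_inv c"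
    by (rule base.transition_isometry[OF c c])
  interpret tg: totally_geodesic_map "chart_map c ` (chart_dom c \<inter> chart_dom c)" ?G
    "chart_image c \<times> chart_image d" "chart_metric (warped_chart lam c d)"
    "\<lambda>x. ((chart_map c \<circ> chart_inv c) x, chart_map d y0)"
    by (rule slice_totally_geodesic[OF c c d])
  have xS: "x \<in> chart_map c ` (chart_dom c \<inter> chart_dom c)" using x by simp
  have F: "?F differentiable at x"
    using f c x smooth_on_differentiable unfolding smooth_function_def by blast
  have "f_tension ?G (chart_metric (warped_chart lam c d)) ?F
      (\<lambda>x. ((chart_map c \<circ> chart_inv c) x, chart_map d y0)) x = 0"
    using harm c d p unfolding f_harmonic_def ball_atlas_warped_product slice_in_charts by simp
  then have "gradient ?G ?F x = 0"
    unfolding tg.f_tension_eq[OF xS] dmap_def by (simp only: iso.fderiv_slice_eq_0_iff[OF xS])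
  then show "fderiv ?F x v = 0"
    using iso.dom.gradient_spec[OF xS F, of v] xS by (simp add: iso.dom.G_simps)
qed

lemma bi_f_harmonic_slice_iff:
  assumes f: "smooth_function M f"
  shows "bi_f_harmonic M (warped_product M lam N) f (\<lambda>x. (x, y0)) \<longleftrightarrow>
    (\<forall>c\<in>atlas M. \<forall>x\<in>chart_image c.
      (let G = chart_metric c; F = f \<circ> chart_inv c; X = gradient G F in
        (2 * F x) *\<^sub>R (trace_cov2 G X x + ricci G X x)
          + gradient G (\<lambda>y. G y (X y) (X y)) x = 0))"
    (is "_ \<longleftrightarrow> (\<forall>c\<in>atlas M. \<forall>x\<in>chart_image c. ?eq c x)")
proof -
  have *: "bi_f_tension (chart_metric c) (chart_metric (warped_chart lam c' d)) (f \<circ> chart_inv c)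
      (\<lambda>x. ((chart_map c' \<circ> chart_inv c) x, chart_map d y0)) (chart_map c p) = 0
    \<longleftrightarrow> ?eq c (chart_map c p)"
    if c: "c \<in> atlas M" "c' \<in> atlas M" and d: "d \<in> atlas N" "y0 \<in> chart_dom d"
      and p: "p \<in> chart_dom c" "p \<in> chart_dom c'" for c c' d p
  proof -
    let ?U = "chart_map c ` (chart_dom c \<inter> chart_dom c')"
    interpret iso: local_isometry ?U "chart_metric c"
      "chart_image c'" "chart_metric c'" "chart_map c' \<circ> chart_inv c"
      by (rule base.transition_isometry[OF c])
    interpret tg: totally_geodesic_map ?U "chart_metric c"
      "chart_image c' \<times> chart_image d" "chart_metric (warped_chart lam c' d)"
      "\<lambda>x. ((chart_map c' \<circ> chart_inv c) x, chart_map d y0)"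
      by (rule slice_totally_geodesic[OF c d])
    have x: "chart_map c p \<in> ?U" using p by blast
    have F: "smooth_on ?U (f \<circ> chart_inv c)"
      using f c(1) unfolding smooth_function_def by (blast intro: smooth_on_subset)
    show ?thesis
      unfolding tg.bi_f_tension_eq[OF x F] Let_def
      \<comment> \<open>The scalar \<open>- (1 / 2)\<close> is nonzero and the differential of the
        slice is injective, so both can be stripped from the equation.\<close>
      by (simp only: scaleR_eq_0_iff iso.fderiv_slice_eq_0_iff[OF x]) simp
  qed
  obtain d where d: "d \<in> atlas N" "y0 \<in> chart_dom d" by (rule exists_fiber_chart)
  show ?thesis
  proof
    assume "bi_f_harmonic M (warped_product M lam N) f (\<lambda>x. (x, y0))"
    \<comment> \<open>One target chart suffices in this direction: \<open>c\<close> itself paired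
      with a fibre chart around \<open>y0\<close>. The converse has to treat every base chart
      \<open>c'\<close> meeting \<open>c\<close>.\<close>
    then have "bi_f_tension (chart_metric c) (chart_metric (warped_chart lam c d)) (f \<circ> chart_inv c)
      (\<lambda>x. ((chart_map c \<circ> chart_inv c) x, chart_map d y0)) (chart_map c p) = 0"
      if "c \<in> atlas M" "p \<in> chart_dom c" for c p
      using that d unfolding bi_f_harmonic_def ball_atlas_warped_product slice_in_charts by simp
    then show "\<forall>c\<in>atlas M. \<forall>x\<in>chart_image c. ?eq c x"
      using *[OF _ _ d] by blast
  next
    assume eq: "\<forall>c\<in>atlas M. \<forall>x\<in>chart_image c. ?eq c x"
    show "bi_f_harmonic M (warped_product M lam N) f (\<lambda>x. (x, y0))"
      unfolding bi_f_harmonic_def ball_atlas_warped_product slice_in_charts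
    proof (intro conjI smooth_map_slice ballI impI)
      fix c c' d p assume "c \<in> atlas M" "c' \<in> atlas M" "d \<in> atlas N" "p \<in> chart_dom c"
        "(p, y0) \<in> chart_dom (warped_chart lam c' d)"
      then show "bi_f_tension (chart_metric c) (chart_metric (warped_chart lam c' d)) (f \<circ> chart_inv c)
        (\<lambda>x. ((chart_map c' \<circ> chart_inv c) x, chart_map d y0)) (chart_map c p) = 0"
        using *[of c c' d p] eq by auto
    qed
  qed
qed

end

theorem theorem5p1:
  fixes M :: "('a, 'e::euclidean_space) riem"
    and N :: "('b, 'n::euclidean_space) riem"
    and lam f :: "'a \<Rightarrow> real" and y0 :: 'b
  assumes "riemannian_manifold M" and "connected_space (mtop M)"
    and "riemannian_manifold N"
    and "smooth_function M lam" and "\<forall>p\<in>topspace (mtop M). lam p > 0"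
    and "y0 \<in> topspace (mtop N)"
    and "smooth_function M f" and "\<forall>p\<in>topspace (mtop M). f p > 0"
    and "\<not> f constant_on topspace (mtop M)"
  shows "nontrivial_bi_f_harmonic M (warped_product M lam N) f (\<lambda>x. (x, y0)) \<longleftrightarrow>
    (\<forall>c\<in>atlas M. \<forall>x\<in>chart_image c.
      (let G = chart_metric c; F = f \<circ> chart_inv c; X = gradient G F in
        (2 * F x) *\<^sub>R (trace_cov2 G X x + ricci G X x)
          + gradient G (\<lambda>y. G y (X y) (X y)) x = 0))"
proof -
  interpret warped_product_slice M N lam y0
    using assms by unfold_locales auto
  show ?thesis
    using bi_f_harmonic_slice_iff[OF assms(7)] f_harmonic_slice_imp_constant[OF assms(2,7)] assms(9)
    unfolding nontrivial_bi_f_harmonic_def by blast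
qed

end
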